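(* Let $E$ be a finite set with $n=|E|$ elements and let $\nu\colon 2^E\to\mathbb{R}\cup\{-\infty\}$ be an $\mathrm{M}^\natural$-concave function. For $0\le k\le n$ and $0<q\le1$ set $I_{q,\nu;k}(\mathbf{x})=\sum_{S\subseteq E,\,|S|=k} q^{-\nu(S)}\mathbf{x}^S$ with $\mathbf{x}^S=\prod_{i\in S}x_i$. Then for all $0<k<n$ and $0<q\le1$ we have the coefficientwise inequality \[ I_{q,\nu;k}(\mathbf{x})^2\succeq \Big(1+\frac1k\Big)I_{q,\nu;k-1}(\mathbf{x})\,I_{q,\nu;k+1}(\mathbf{x}). \]
   Context: A function $\nu\colon 2^E\to\mathbb{R}\cup\{-\infty\}$ is $\mathrm{M}^\natural$-concave if for any $I_1,I_2\subseteq E$ and $i_1\in I_1\setminus I_2$, either $\nu(I_1)+\nu(I_2)\le \nu(I_1\setminus i_1)+\nu(I_2\cup i_1)$, or there is $i_2\in I_2\setminus I_1$ with $\nu(I_1)+\nu(I_2)\le \nu((I_1\setminus i_1)\cup i_2)+\nu((I_2\setminus i_2)\cup i_1)$; its effective domain $\{S:\nu(S)\ne-\infty\}$ is assumed nonempty. Convention $q^{\infty}=0$. For real polynomials $f,g$ in the variables $(x_i)_{i\in E}$, $f\succeq g$ means every coefficient of $f-g$ is nonnegative. *)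

theory Defs
  imports "HOL-Analysis.Analysis" "HOL-Library.Poly_Mapping"
begin

definition Mnat_concave :: "('e::finite set \<Rightarrow> ereal) \<Rightarrow> bool" where
  "Mnat_concave \<nu> \<longleftrightarrow>
     (\<forall>S. \<nu> S \<noteq> \<infinity>) \<and> (\<exists>S. \<nu> S \<noteq> -\<infinity>) \<and>
     (\<forall>I1 I2 i1. i1 \<in> I1 - I2 \<longrightarrow>
        (\<nu> I1 + \<nu> I2 \<le> \<nu> (I1 - {i1}) + \<nu> (insert i1 I2)) \<or>
        (\<exists>i2 \<in> I2 - I1. \<nu> I1 + \<nu> I2 \<le> \<nu> (insert i2 (I1 - {i1})) + \<nu> (insert i1 (I2 - {i2}))))"

type_synonym 'e mpoly = "('e \<Rightarrow>\<^sub>0 nat) \<Rightarrow>\<^sub>0 real"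

text \<open>q^{-v} with the convention q^{\<infinity>} = 0 (i.e. value 0 when v = -\<infinity>).\<close>
definition qpow :: "real \<Rightarrow> ereal \<Rightarrow> real" where
  "qpow q v = (if v = -\<infinity> then 0 else q powr (- real_of_ereal v))"

definition monexp :: "'e set \<Rightarrow> ('e \<Rightarrow>\<^sub>0 nat)" where
  "monexp S = (\<Sum>i\<in>S. Poly_Mapping.single i 1)"

definition I_poly :: "real \<Rightarrow> ('e::finite set \<Rightarrow> ereal) \<Rightarrow> nat \<Rightarrow> 'e mpoly" where
  "I_poly q \<nu> k = (\<Sum>S\<in>{S. card S = k}. Poly_Mapping.single (monexp S) (qpow q (\<nu> S)))"

definition coeff_ge :: "'e mpoly \<Rightarrow> 'e mpoly \<Rightarrow> bool" where
  "coeff_ge f g \<longleftrightarrow> (\<forall>m. Poly_Mapping.lookup (f - g) m \<ge> 0)"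

definition const_poly :: "real \<Rightarrow> 'e mpoly" where
  "const_poly c = Poly_Mapping.single 0 c"

end

(*
  Write f(x, z) for the sum of w(S) x^S z^(n - |S|) with w = q^(-nu).  The multiplicative exchange
  property of w makes f Lorentzian: its second-order derivatives are quadratic forms with at
  most one positive eigenvalue.  For the latter one completes the square in a suitable variable and
  is left with a form (p_ij) y_i y_j whose matrix p is an ultrametric.  The coefficient of a monomial
  in I_k^2 and in I_(k-1) I_(k+1) is, after passing to a minor with a ground set B of size n = 2 m,
  the sum of w(S) w(B - S) over |S| = m and |S| = m - 1.  Differentiating the Lorentzian polynomial
  f(x, z) f(y, u) in the directions x_i + y_i for all i in B, and m - 1 times each in z and u, leaves
  a quadratic form in z and u with these sums as coefficients up to factorials, and the reverse
  Cauchy-Schwarz inequality for it is the claim.  That directional derivatives of a Lorentzian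
  polynomial again satisfy reverse Cauchy-Schwarz is shown by the Bochner method of Shenfeld and
  van Handel: for the matrix A obtained from the form by normalising its Perron vector to
  eigenvalue 1, the inequality one degree lower gives A^2 >= A, so that no eigenvalue lies strictly
  between 0 and 1, while connectedness makes the eigenvalue 1 simple.
*)
theory Submission
  imports Defs
begin

text \<open>The factor in the theorem is a quotient of factorials of the homogenising variable. With
  |B| = 2p + 2, the terms z^(p+2) u^p and z^(p+1) u^(p+1) contribute (p+2)! p! and ((p+1)!)^2, with
  quotient 1 + 1/(p+1). Here p + 1 is k minus the number of squared variables, so this is at least 1
  + 1/k. The same quotient decides whether the homogenised polynomial is Lorentzian: after
  differentiating in a set R of x-variables and t times in z, two short of the degree |B|, exactly t
  + 2 = |B - R| variables x_i remain, and (t+2)! t! / ((t+1)!)^2 = (t+2)/(t+1) is the largest factor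
  that an ultrametric form on t + 2 points tolerates. Hence the degree is the size of the ground
  set, and passing to a minor fits that size to the monomial. Another obstacle is that the Bochner
  step divides by the coordinates of the direction, whereas the directions of interest have many
  zeros. The eigenvalue condition is therefore stated as a polynomial inequality, which survives
  limits.\<close>

section \<open>Forms with at most one positive eigenvalue\<close>

definition bform :: "('n::finite \<Rightarrow> 'n \<Rightarrow> real) \<Rightarrow> ('n \<Rightarrow> real) \<Rightarrow> ('n \<Rightarrow> real) \<Rightarrow> real" where
  "bform Q x y = (\<Sum>i\<in>UNIV. \<Sum>j\<in>UNIV. Q i j * x i * y j)"

text \<open>For symmetric \<open>Q\<close> with nonnegative entries this is equivalent to having at
  most one positive eigenvalue. It is a closed condition in \<open>Q\<close> and is already the
  inequality wanted at the end.\<close>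

definition hyperbolic :: "('n::finite \<Rightarrow> 'n \<Rightarrow> real) \<Rightarrow> bool" where
  "hyperbolic Q \<longleftrightarrow>
     (\<forall>x v. (\<forall>i. 0 \<le> v i) \<longrightarrow> bform Q x x * bform Q v v \<le> (bform Q x v)\<^sup>2)"

lemma bform_nonneg:
  assumes "\<And>i j. 0 \<le> Q i j" "\<And>i. 0 \<le> x i" "\<And>i. 0 \<le> y i"
  shows "0 \<le> bform Q x y"
  unfolding bform_def using assms by (intro sum_nonneg mult_nonneg_nonneg) auto

lemma bform_commute:
  assumes "\<And>i j. Q i j = Q j i"
  shows "bform Q x y = bform Q y x"
  unfolding bform_def
  by (subst sum.swap) (intro sum.cong refl, metis assms mult.assoc mult.commute)

lemma bform_lincomb:
  "bform Q (\<lambda>i. a * x i + b * y i) z = a * bform Q x z + b * bform Q y z"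
  "bform Q z (\<lambda>i. a * x i + b * y i) = a * bform Q z x + b * bform Q z y"
  unfolding bform_def
  by (simp_all add: algebra_simps sum.distrib sum_distrib_left)

text \<open>The span of \<open>x\<close> and \<open>u\<close> meets the hyperplane l = 0 in a
  combination of the two, and the form is nonpositive there. If the form is positive at
  \<open>x\<close>, this forces the discriminant on the span to have the right sign.\<close>

lemma hyperbolicI:
  fixes Q :: "'n::finite \<Rightarrow> 'n \<Rightarrow> real"
  assumes sym: "\<And>i j. Q i j = Q j i" and nonneg: "\<And>i j. 0 \<le> Q i j"
    and neg: "\<And>x. (\<Sum>i\<in>UNIV. l i * x i) = 0 \<Longrightarrow> bform Q x x \<le> 0"
  shows "hyperbolic Q"
  unfolding hyperbolic_def
proof (intro allI impI)
  fix x u :: "'n \<Rightarrow> real" assume u: "\<forall>i. 0 \<le> u i"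
  define X where "X = bform Q x x"
  define U where "U = bform Q u u"
  define Y where "Y = bform Q x u"
  have "U \<ge> 0" unfolding U_def using nonneg u by (intro bform_nonneg) auto
  show "bform Q x x * bform Q u u \<le> (bform Q x u)\<^sup>2"
  proof (cases "X \<le> 0")
    case True
    then have "X * U \<le> 0" using \<open>U \<ge> 0\<close> by (simp add: mult_nonpos_nonneg)
    then show ?thesis unfolding X_def U_def by (smt (verit) zero_le_power2)
  next
    case False
    define a where "a = (\<Sum>i\<in>UNIV. l i * u i)"
    define b where "b = - (\<Sum>i\<in>UNIV. l i * x i)"
    have "b \<noteq> 0" using False neg[of x] unfolding b_def X_def by auto
    have "(\<Sum>i\<in>UNIV. l i * (a * x i + b * u i))
        = a * (\<Sum>i\<in>UNIV. l i * x i) + b * (\<Sum>i\<in>UNIV. l i * u i)"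
      by (simp add: algebra_simps sum.distrib sum_distrib_left)
    also have "\<dots> = 0" unfolding a_def b_def by simp
    finally have "bform Q (\<lambda>i. a * x i + b * u i) (\<lambda>i. a * x i + b * u i) \<le> 0"
      by (rule neg)
    then have le: "a\<^sup>2 * X + 2 * a * b * Y + b\<^sup>2 * U \<le> 0"
      unfolding bform_lincomb X_def U_def Y_def bform_commute[of Q u x, OF sym]
      by (simp add: algebra_simps power2_eq_square)
    \<comment> \<open>Completing the square in the quadratic form in \<open>a\<close> and
      \<open>b\<close>, multiplied by X > 0.\<close>
    have "(a * X + b * Y)\<^sup>2 + b\<^sup>2 * (X * U - Y\<^sup>2) = X * (a\<^sup>2 * X + 2 * a * b * Y + b\<^sup>2 * U)"
      by (simp add: algebra_simps power2_eq_square)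
    also have "\<dots> \<le> 0" using le False by (simp add: mult_nonneg_nonpos)
    finally have "b\<^sup>2 * (X * U - Y\<^sup>2) \<le> 0" by (smt (verit) zero_le_power2)
    then have "X * U - Y\<^sup>2 \<le> 0" using \<open>b \<noteq> 0\<close>
      by (simp add: mult_le_0_iff)
    then show ?thesis unfolding X_def U_def Y_def by simp
  qed
qed

section \<open>Spectral gap and the Bochner step\<close>

lemma psd_Cauchy_Schwarz:
  fixes T :: "'a::real_inner \<Rightarrow> 'a"
  assumes T: "linear T" and sym: "\<And>x y. x \<bullet> T y = T x \<bullet> y" and psd: "\<And>x. 0 \<le> x \<bullet> T x"
  shows "(x \<bullet> T y)\<^sup>2 \<le> (x \<bullet> T x) * (y \<bullet> T y)"
proof -
  have yx: "y \<bullet> T x = x \<bullet> T y" by (metis sym inner_commute)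
  have expand: "(x + t *\<^sub>R y) \<bullet> T (x + t *\<^sub>R y) = x \<bullet> T x + 2 * t * (x \<bullet> T y) + t\<^sup>2 * (y \<bullet> T y)" for t
    using T by (simp add: linear_add linear_scale inner_add yx algebra_simps power2_eq_square)
  show ?thesis
  proof (cases "y \<bullet> T y = 0")
    case True
    have "x \<bullet> T y = 0"
    proof (rule ccontr)
      assume n: "x \<bullet> T y \<noteq> 0"
      have "0 \<le> x \<bullet> T x + 2 * (- (x \<bullet> T x + 1) / (2 * (x \<bullet> T y))) * (x \<bullet> T y)"
        using psd expand[of "- (x \<bullet> T x + 1) / (2 * (x \<bullet> T y))"] True by (metis add.right_neutral mult_zero_right)
      then show False using n by (simp add: field_simps)
    qed
    then show ?thesis using True by simp
  next
    case False
    then have pos: "y \<bullet> T y > 0" using psd[of y] by linarith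
    have "0 \<le> x \<bullet> T x + 2 * (- (x \<bullet> T y) / (y \<bullet> T y)) * (x \<bullet> T y) + (- (x \<bullet> T y) / (y \<bullet> T y))\<^sup>2 * (y \<bullet> T y)"
      using psd expand by metis
    then show ?thesis using pos by (simp add: field_simps power2_eq_square)
  qed
qed

text \<open>In spectral terms, T^2 >= T leaves no eigenvalue strictly between 0 and 1, so T >= 1 off
  the kernel. No diagonalisation is used: a vector orthogonal to the kernel has the form x = T y,
  and Cauchy-Schwarz for the form of T bounds (x . x)^2 by (y . T y)(x . T x), where y . T y <= T y
  . T y = x . x.\<close>

lemma psd_gap:
  fixes T :: "'a::euclidean_space \<Rightarrow> 'a"
  assumes T: "linear T" and sym: "\<And>x y. x \<bullet> T y = T x \<bullet> y" and psd: "\<And>x. 0 \<le> x \<bullet> T x"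
    and sq: "\<And>x. x \<bullet> T x \<le> T x \<bullet> T x"
    and ker: "\<And>y. T y = 0 \<Longrightarrow> x \<bullet> y = 0"
  shows "x \<bullet> x \<le> x \<bullet> T x"
proof -
  have adj: "adjoint T = T"
    by (rule adjoint_unique) (simp add: sym)
  have "x \<in> orthogonal_comp (T -` {0})"
    using ker by (auto simp: orthogonal_comp_def orthogonal_def inner_commute)
  also have "orthogonal_comp (T -` {0}) = range T"
    using ker_orthogonal_comp_adjoint[OF T] adj T
    by (simp add: orthogonal_comp_self linear_subspace_image)
  finally obtain y where y: "x = T y" by auto
  have "(x \<bullet> x)\<^sup>2 = (y \<bullet> T x)\<^sup>2" by (simp add: y sym)
  also have "\<dots> \<le> (y \<bullet> T y) * (x \<bullet> T x)" by (rule psd_Cauchy_Schwarz[OF T sym psd])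
  also have "\<dots> \<le> (x \<bullet> x) * (x \<bullet> T x)"
    using sq[of y] psd[of x] by (intro mult_right_mono) (auto simp: y)
  finally have "(x \<bullet> x) * (x \<bullet> x) \<le> (x \<bullet> x) * (x \<bullet> T x)" by (simp add: power2_eq_square)
  then show ?thesis
    by (cases "x = 0") (auto simp: mult_le_cancel_left)
qed

text \<open>Think of \<open>g l\<close> as the form of the l-th partial derivative of a polynomial
  and of \<open>H\<close> as the form of its derivative in direction \<open>v\<close>. The work is
  done with T = I - R, R being the normalised matrix: R^2 >= R is the same as T^2 >= T, and T is
  positive semidefinite, so \<open>psd_gap\<close> applies to it. By \<open>conn\<close> the kernel
  of T lies in the line through the Perron vector \<open>p\<close>, and on its complement x . x <= x
  . T x says x . R x <= 0.\<close>

lemma hyperbolic_bochner: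
  fixes g :: "'n::finite \<Rightarrow> 'n \<Rightarrow> 'n \<Rightarrow> real" and v :: "'n \<Rightarrow> real"
  defines "H \<equiv> \<lambda>i j. \<Sum>l\<in>UNIV. v l * g l i j"
  assumes sym1: "\<And>i j l. g i j l = g j i l" and sym2: "\<And>i j l. g i j l = g i l j"
    and nonneg: "\<And>i j l. 0 \<le> g i j l" and v: "\<And>i. 0 < v i"
    and hyp: "\<And>l. hyperbolic (g l)"
    and conn: "\<And>i j a b. H i a \<noteq> 0 \<Longrightarrow> H j b \<noteq> 0 \<Longrightarrow> i = j \<or> H i j \<noteq> 0 \<or> (\<exists>l. H i l \<noteq> 0 \<and> H l j \<noteq> 0)"
  shows "hyperbolic H"
proof -
  define h where "h i = (\<Sum>j\<in>UNIV. H i j * v j)" for i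
  \<comment> \<open>With D the diagonal matrix of h_i / v_i, \<open>S\<close> is D^(-1/2) H
    D^(-1/2), and p = D^(1/2) v is fixed by it. Where h_i = 0 the whole row of \<open>H\<close>
    vanishes, so the default value 0 of the division is the right entry.\<close>
  define s where "s i = sqrt (h i / v i)" for i
  define S where "S i j = H i j / (s i * s j)" for i j
  define R where "R x = (\<chi> i. \<Sum>j\<in>UNIV. S i j * x $ j)" for x :: "real^'n"
  define T where "T x = x - R x" for x :: "real^'n"
  define p where "p = (\<chi> i. s i * v i)"
  define Y where "Y x i = x $ i / s i" for x :: "real^'n" and i
  have v0: "v i \<noteq> 0" "0 \<le> v i" for i using v[of i] by auto
  have Hnn: "0 \<le> H i j" for i j
    unfolding H_def using nonneg v0 by (intro sum_nonneg mult_nonneg_nonneg) auto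
  have Hsym: "H i j = H j i" for i j
    unfolding H_def by (simp add: sym2)
  have hnn: "0 \<le> h i" for i
    unfolding h_def using Hnn v0 by (intro sum_nonneg mult_nonneg_nonneg) auto
  have h0: "H i j = 0" if "h i = 0" for i j
  proof -
    have "H i j * v j = 0"
      using that Hnn v0 unfolding h_def by (subst (asm) sum_nonneg_eq_0_iff) auto
    then show ?thesis using v0 by simp
  qed
  have s2: "s i * s i = h i / v i" for i
    unfolding s_def using hnn[of i] v0(2)[of i] by simp
  have s0: "s i = 0 \<longleftrightarrow> h i = 0" for i
    unfolding s_def using v0 by simp
  have HS: "H i j = S i j * s i * s j" for i j
    using h0[of i j] h0[of j i] Hsym[of i j] unfolding S_def by (auto simp: s0)
  have Ssym: "S i j = S j i" for i j
    unfolding S_def by (simp add: Hsym mult.commute)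
  have quad: "x \<bullet> R x = bform H (Y x) (Y x)" for x
    unfolding R_def inner_vec_def bform_def Y_def S_def
    by (simp add: sum_distrib_left algebra_simps)
  have Rnth: "R x $ i = (\<Sum>j\<in>UNIV. H i j * Y x j) / s i" for x i
    unfolding R_def Y_def S_def by (simp add: sum_divide_distrib algebra_simps)
  have linR: "linear R"
    unfolding R_def by (rule linearI)
      (auto simp: vec_eq_iff algebra_simps sum.distrib sum_distrib_left)
  have linT: "linear T"
    unfolding T_def by (intro linear_compose_sub linR linear_ident)
  have symR: "x \<bullet> R y = R x \<bullet> y" for x y
  proof -
    have "x \<bullet> R y = (\<Sum>i\<in>UNIV. \<Sum>j\<in>UNIV. S i j * x $ i * y $ j)"
      unfolding R_def inner_vec_def by (simp add: sum_distrib_left algebra_simps)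
    also have "\<dots> = (\<Sum>j\<in>UNIV. \<Sum>i\<in>UNIV. S i j * x $ i * y $ j)" by (rule sum.swap)
    also have "\<dots> = R x \<bullet> y"
      unfolding R_def inner_vec_def by (simp add: sum_distrib_left sum_distrib_right algebra_simps Ssym)
    finally show ?thesis .
  qed
  have symT: "x \<bullet> T y = T x \<bullet> y" for x y
    unfolding T_def by (simp add: inner_diff symR)
  \<comment> \<open>The Dirichlet form of the graph with edge weights H_ij v_i v_j, evaluated at y_i
    / v_i. Its nonnegativity gives R <= I, and where it vanishes the ratios y_i / v_i agree along
    edges.\<close>
  define Lap where "Lap y = (\<Sum>i\<in>UNIV. \<Sum>j\<in>UNIV. H i j * v i * v j * (y i / v i - y j / v j)\<^sup>2) / 2" for y
  have Lap: "(\<Sum>i\<in>UNIV. h i / v i * (y i)\<^sup>2) - bform H y y = Lap y" for y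
  proof -
    have a: "(\<Sum>i\<in>UNIV. h i / v i * (y i)\<^sup>2) = (\<Sum>i\<in>UNIV. \<Sum>j\<in>UNIV. H i j * v j / v i * (y i)\<^sup>2)"
      unfolding h_def by (simp add: sum_divide_distrib sum_distrib_right)
    also have "\<dots> = (\<Sum>j\<in>UNIV. \<Sum>i\<in>UNIV. H i j * v j / v i * (y i)\<^sup>2)" by (rule sum.swap)
    also have "\<dots> = (\<Sum>i\<in>UNIV. \<Sum>j\<in>UNIV. H i j * v i / v j * (y j)\<^sup>2)"
      by (simp add: Hsym)
    finally have b: "(\<Sum>i\<in>UNIV. h i / v i * (y i)\<^sup>2) = (\<Sum>i\<in>UNIV. \<Sum>j\<in>UNIV. H i j * v i / v j * (y j)\<^sup>2)" .
    have t: "H i j * v i * v j * (y i / v i - y j / v j)\<^sup>2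
        = H i j * v j / v i * (y i)\<^sup>2 + H i j * v i / v j * (y j)\<^sup>2 - 2 * (H i j * y i * y j)" for i j
      using v0[of i] v0[of j] by (simp add: field_simps power2_eq_square)
    have "(\<Sum>i\<in>UNIV. \<Sum>j\<in>UNIV. H i j * v i * v j * (y i / v i - y j / v j)\<^sup>2)
        = (\<Sum>i\<in>UNIV. \<Sum>j\<in>UNIV. H i j * v j / v i * (y i)\<^sup>2)
        + (\<Sum>i\<in>UNIV. \<Sum>j\<in>UNIV. H i j * v i / v j * (y j)\<^sup>2) - 2 * bform H y y"
      unfolding t bform_def sum_distrib_left by (simp add: sum.distrib sum_subtractf)
    then have "2 * Lap y = (\<Sum>i\<in>UNIV. h i / v i * (y i)\<^sup>2) + (\<Sum>i\<in>UNIV. h i / v i * (y i)\<^sup>2) - 2 * bform H y y"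
      unfolding Lap_def using a b by simp
    then show ?thesis by simp
  qed
  have Lap_nn: "0 \<le> Lap y" for y
    unfolding Lap_def using Hnn v0 by (intro divide_nonneg_nonneg sum_nonneg mult_nonneg_nonneg) auto
  \<comment> \<open>Only an inequality, because \<open>Y\<close> forgets the coordinates with s_i =
    0.\<close>
  have le_norm: "(\<Sum>i\<in>UNIV. h i / v i * (Y x i)\<^sup>2) \<le> x \<bullet> x" for x
    unfolding inner_vec_def Y_def using hnn v0
    by (intro sum_mono) (auto simp: s2[symmetric] power2_eq_square)
  have quad_le: "x \<bullet> T x \<ge> Lap (Y x)" for x
    using Lap[of "Y x"] le_norm[of x] unfolding T_def inner_diff quad by linarith
  have psd: "0 \<le> x \<bullet> T x" for x
    using quad_le[of x] Lap_nn[of "Y x"] by linarith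
  have RR: "x \<bullet> R x \<le> R x \<bullet> R x" for x
  proof -
    define y where "y = Y x"
    \<comment> \<open>By full symmetry of \<open>g\<close>, contracting \<open>H\<close> with
      \<open>y\<close> is the same as contracting \<open>g l\<close> with \<open>y\<close> and
      \<open>v\<close>. So the hypothesis on \<open>g l\<close>, applied to \<open>y\<close> and
      \<open>v\<close>, bounds each summand of the form of \<open>H\<close> by a squared coordinate
      of R x.\<close>
    have Hy: "(\<Sum>j\<in>UNIV. H l j * y j) = bform (g l) y v" for l y
      unfolding H_def bform_def sum_distrib_right
      by (intro sum.cong refl) (metis (no_types) sym1 sym2 mult.commute mult.assoc)
    have hl: "h l = bform (g l) v v" for l unfolding h_def Hy by simp
    have "x \<bullet> R x = (\<Sum>i\<in>UNIV. \<Sum>j\<in>UNIV. \<Sum>l\<in>UNIV. v l * (g l i j * y i * y j))"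
      unfolding quad y_def[symmetric] bform_def H_def by (simp add: sum_distrib_left sum_distrib_right algebra_simps)
    also have "\<dots> = (\<Sum>i\<in>UNIV. \<Sum>l\<in>UNIV. \<Sum>j\<in>UNIV. v l * (g l i j * y i * y j))"
      by (intro sum.cong refl sum.swap)
    also have "\<dots> = (\<Sum>l\<in>UNIV. \<Sum>i\<in>UNIV. \<Sum>j\<in>UNIV. v l * (g l i j * y i * y j))"
      by (rule sum.swap)
    also have "\<dots> = (\<Sum>l\<in>UNIV. v l * bform (g l) y y)"
      by (simp add: bform_def sum_distrib_left)
    also have "\<dots> \<le> (\<Sum>l\<in>UNIV. (bform (g l) y v / s l) * (bform (g l) y v / s l))"
    proof (intro sum_mono)
      fix l
      show "v l * bform (g l) y y \<le> (bform (g l) y v / s l) * (bform (g l) y v / s l)"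
      proof (cases "h l = 0")
        case True
        have "g l i j = 0" for i j
        proof -
          have "(\<Sum>k\<in>UNIV. v k * g k l i) = 0"
            using h0[OF True, of i] unfolding H_def by simp
          then have "v j * g j l i = 0"
            using v0 nonneg by (subst (asm) sum_nonneg_eq_0_iff) auto
          then show ?thesis using v0[of j] sym1 sym2 by (metis mult_eq_0_iff)
        qed
        then show ?thesis by (simp add: bform_def)
      next
        case False
        then have pos: "h l > 0" using hnn[of l] by linarith
        have "bform (g l) y y * h l \<le> (bform (g l) y v)\<^sup>2"
          using hyp[of l] v0 unfolding hyperbolic_def hl by blast
        then have "v l * bform (g l) y y \<le> v l * ((bform (g l) y v)\<^sup>2 / h l)"
          using pos v0 by (intro mult_left_mono) (auto simp: field_simps)
        also have "\<dots> = (bform (g l) y v / s l) * (bform (g l) y v / s l)"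
          using s2[of l] pos v0[of l] by (simp add: power2_eq_square)
        finally show ?thesis .
      qed
    qed
    also have "\<dots> = R x \<bullet> R x"
      unfolding inner_vec_def Rnth y_def[symmetric] Hy by simp
    finally show ?thesis .
  qed
  have sq: "x \<bullet> T x \<le> T x \<bullet> T x" for x
    using RR[of x] symR[of x x] unfolding T_def by (simp add: inner_diff)
  have kern: "\<exists>c. z = c *\<^sub>R p" if "T z = 0" for z
  proof -
    have zR: "z = R z" using that by (simp add: T_def)
    have z0: "z $ i = 0" if "h i = 0" for i
      using that by (subst zR) (simp add: Rnth s0[symmetric])
    have "Lap (Y z) = 0" using quad_le[of z] Lap_nn[of "Y z"] that by simp
    then have "(\<Sum>i\<in>UNIV. \<Sum>j\<in>UNIV. H i j * v i * v j * (Y z i / v i - Y z j / v j)\<^sup>2) = 0"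
      unfolding Lap_def by simp
    then have e: "H i j * v i * v j * (Y z i / v i - Y z j / v j)\<^sup>2 = 0" for i j
      using Hnn v0 by (subst (asm) sum_nonneg_eq_0_iff; (subst (asm) sum_nonneg_eq_0_iff)?)
        (auto intro!: sum_nonneg mult_nonneg_nonneg)
    have step: "Y z i / v i = Y z j / v j" if "H i j \<noteq> 0" for i j
      using e[of i j] that v0 by simp
    have const: "Y z i / v i = Y z j / v j" if "h i \<noteq> 0" "h j \<noteq> 0" for i j
    proof -
      obtain a where a: "H i a \<noteq> 0" using \<open>h i \<noteq> 0\<close> unfolding h_def by fastforce
      obtain b where b: "H j b \<noteq> 0" using \<open>h j \<noteq> 0\<close> unfolding h_def by fastforce
      show ?thesis using conn[OF a b] step by metis
    qed
    show ?thesis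
    proof (cases "\<exists>k. h k \<noteq> 0")
      case True
      then obtain k where k: "h k \<noteq> 0" by blast
      have "z $ i = (Y z k / v k) * (s i * v i)" for i
      proof (cases "h i = 0")
        case True
        then show ?thesis using z0 s0 by simp
      next
        case False
        then have "Y z i = (Y z k / v k) * v i"
          using const[OF False k] v0[of i] by (simp add: field_simps)
        moreover have "z $ i = s i * Y z i"
          using False s0[of i] unfolding Y_def by simp
        ultimately show ?thesis by simp
      qed
      then have "z = (Y z k / v k) *\<^sub>R p" by (simp add: vec_eq_iff p_def)
      then show ?thesis by blast
    next
      case False
      then have "z = 0 *\<^sub>R p" using z0 by (simp add: vec_eq_iff)
      then show ?thesis by blast
    qed
  qed
  show ?thesis
  proof (rule hyperbolicI[where l = h])
    fix y :: "'n \<Rightarrow> real" assume y: "(\<Sum>i\<in>UNIV. h i * y i) = 0"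
    \<comment> \<open>This substitution turns the form of \<open>H\<close> at \<open>y\<close> into
      that of \<open>R\<close> at \<open>x\<close>, and the hyperplane orthogonal to H v into the
      one orthogonal to \<open>p\<close>.\<close>
    define x where "x = (\<chi> i. s i * y i)"
    have "x \<bullet> p = (\<Sum>i\<in>UNIV. (s i * s i) * (v i * y i))"
      unfolding x_def p_def inner_vec_def by (simp add: algebra_simps)
    also have "\<dots> = (\<Sum>i\<in>UNIV. h i * y i)"
      unfolding s2 using v0 by simp
    finally have "x \<bullet> p = 0" using y by simp
    then have "x \<bullet> x \<le> x \<bullet> T x"
      using kern by (intro psd_gap linT symT psd sq) force
    then have "x \<bullet> R x \<le> 0" by (simp add: T_def inner_diff)
    also have "x \<bullet> R x = bform H y y"
      unfolding R_def x_def inner_vec_def bform_def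
      by (simp add: HS sum_distrib_left algebra_simps)
    finally show "bform H y y \<le> 0" .
  qed (use Hsym Hnn in auto)
qed

section \<open>Lorentzian polynomials\<close>

text \<open>A homogeneous polynomial is encoded by the values W(\<alpha>) of its partial derivatives
  of top order, \<alpha> being the multiset of differentiation variables: W(\<alpha>) is the
  coefficient of x to the power \<alpha> times the factorials of the multiplicities.  Differentiation is
  then a shift, without numerical factors.\<close>

definition dir_deriv :: "('n::finite \<Rightarrow> real) \<Rightarrow> ('n multiset \<Rightarrow> real) \<Rightarrow> 'n multiset \<Rightarrow> real" where
  "dir_deriv v W \<alpha> = (\<Sum>i\<in>UNIV. v i * W (add_mset i \<alpha>))"

text \<open>The second condition is the one-sided exchange axiom for the support, the last concerns
  the quadratic forms left after all but two differentiations. Comparing only multisets of equal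
  size treats each homogeneous part separately.\<close>

definition Lorentzian :: "('n::finite multiset \<Rightarrow> real) \<Rightarrow> bool" where
  "Lorentzian W \<longleftrightarrow>
     (\<forall>\<alpha>. 0 \<le> W \<alpha>) \<and>
     (\<forall>\<alpha> \<beta> j. W \<alpha> \<noteq> 0 \<longrightarrow> W \<beta> \<noteq> 0 \<longrightarrow> size \<alpha> = size \<beta> \<longrightarrow> count \<alpha> j < count \<beta> j \<longrightarrow>
        (\<exists>k. count \<beta> k < count \<alpha> k \<and> W (add_mset j (\<alpha> - {#k#})) \<noteq> 0)) \<and>
     (\<forall>\<alpha>. hyperbolic (\<lambda>i j. W (\<alpha> + {#i, j#})))"

section \<open>Iterated directional derivatives and their supports\<close>

lemma foldr_dir_deriv_add_mset:
  "foldr dir_deriv vs (\<lambda>\<alpha>. W (add_mset l \<alpha>)) \<alpha> = foldr dir_deriv vs W (add_mset l \<alpha>)"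
  by (induction vs arbitrary: \<alpha>) (simp_all add: dir_deriv_def add_mset_commute)

lemma foldr_dir_deriv_nonneg:
  assumes "\<And>\<alpha>. 0 \<le> W \<alpha>" "\<And>v i. v \<in> set vs \<Longrightarrow> 0 \<le> v i"
  shows "0 \<le> foldr dir_deriv vs W \<alpha>"
  using assms(2)
  by (induction vs arbitrary: \<alpha>) (auto simp: dir_deriv_def assms(1) intro!: sum_nonneg mult_nonneg_nonneg)

text \<open>All terms are nonnegative and all direction coordinates positive, so nothing cancels.
  This reads off the graph of the derived form from the support of \<open>W\<close>, to which the
  exchange axiom applies.\<close>

lemma foldr_dir_deriv_neq_0_iff:
  assumes "\<And>\<alpha>. 0 \<le> W \<alpha>" "\<And>v i. v \<in> set vs \<Longrightarrow> 0 < v i"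
  shows "foldr dir_deriv vs W \<alpha> \<noteq> 0 \<longleftrightarrow> (\<exists>\<gamma>. size \<gamma> = length vs \<and> W (\<alpha> + \<gamma>) \<noteq> 0)"
  using assms(2)
proof (induction vs arbitrary: \<alpha>)
  case Nil
  then show ?case by simp
next
  case (Cons v vs)
  have vpos: "0 < v i" for i using Cons.prems by simp
  have nn: "0 \<le> foldr dir_deriv vs W \<beta>" for \<beta>
    using Cons.prems by (intro foldr_dir_deriv_nonneg assms(1)) (auto intro: less_imp_le)
  have "foldr dir_deriv vs W \<beta> \<noteq> 0 \<longleftrightarrow> (\<exists>\<gamma>. size \<gamma> = length vs \<and> W (\<beta> + \<gamma>) \<noteq> 0)" for \<beta>
    using Cons.prems by (intro Cons.IH) simp
  then have IH: "foldr dir_deriv vs W \<beta> = 0 \<longleftrightarrow> (\<forall>\<gamma>. size \<gamma> = length vs \<longrightarrow> W (\<beta> + \<gamma>) = 0)" for \<beta>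
    by blast
  have "foldr dir_deriv (v # vs) W \<alpha> = 0 \<longleftrightarrow> (\<forall>i. v i * foldr dir_deriv vs W (add_mset i \<alpha>) = 0)"
    using nn vpos by (simp add: dir_deriv_def sum_nonneg_eq_0_iff less_imp_le)
  also have "\<dots> \<longleftrightarrow> (\<forall>i. foldr dir_deriv vs W (add_mset i \<alpha>) = 0)"
    using vpos by (metis mult_eq_0_iff less_irrefl)
  also have "\<dots> \<longleftrightarrow> (\<forall>i \<gamma>. size \<gamma> = length vs \<longrightarrow> W (add_mset i (\<alpha> + \<gamma>)) = 0)"
    using IH by simp
  also have "\<dots> \<longleftrightarrow> (\<forall>\<gamma>. size \<gamma> = Suc (length vs) \<longrightarrow> W (\<alpha> + \<gamma>) = 0)"
  proof
    assume a: "\<forall>i \<gamma>. size \<gamma> = length vs \<longrightarrow> W (add_mset i (\<alpha> + \<gamma>)) = 0"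
    show "\<forall>\<gamma>. size \<gamma> = Suc (length vs) \<longrightarrow> W (\<alpha> + \<gamma>) = 0"
    proof (intro allI impI)
      fix \<gamma> :: "'a multiset" assume "size \<gamma> = Suc (length vs)"
      then obtain i \<delta> where "\<gamma> = add_mset i \<delta>" "size \<delta> = length vs"
        by (metis size_eq_Suc_imp_eq_union size_add_mset nat.inject)
      then show "W (\<alpha> + \<gamma>) = 0" using a by simp
    qed
  next
    assume a: "\<forall>\<gamma>. size \<gamma> = Suc (length vs) \<longrightarrow> W (\<alpha> + \<gamma>) = 0"
    show "\<forall>i \<gamma>. size \<gamma> = length vs \<longrightarrow> W (add_mset i (\<alpha> + \<gamma>)) = 0"
    proof (intro allI impI)
      fix i and \<gamma> :: "'a multiset" assume "size \<gamma> = length vs"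
      then show "W (add_mset i (\<alpha> + \<gamma>)) = 0"
        using a[rule_format, of "add_mset i \<gamma>"] by simp
    qed
  qed
  finally show ?case by simp
qed

lemma Lorentzian_add_mset:
  assumes "Lorentzian W"
  shows "Lorentzian (\<lambda>\<alpha>. W (add_mset l \<alpha>))"
proof -
  have nn: "\<And>\<alpha>. 0 \<le> W \<alpha>"
    and ex: "\<And>\<alpha> \<beta> j. W \<alpha> \<noteq> 0 \<Longrightarrow> W \<beta> \<noteq> 0 \<Longrightarrow> size \<alpha> = size \<beta> \<Longrightarrow> count \<alpha> j < count \<beta> j \<Longrightarrow>
        (\<exists>k. count \<beta> k < count \<alpha> k \<and> W (add_mset j (\<alpha> - {#k#})) \<noteq> 0)"
    and hyp: "\<And>\<alpha>. hyperbolic (\<lambda>i j. W (\<alpha> + {#i, j#}))"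
    using assms unfolding Lorentzian_def by blast+
  show ?thesis unfolding Lorentzian_def
  proof (intro conjI allI impI)
    fix \<alpha> \<beta> j
    assume a: "W (add_mset l \<alpha>) \<noteq> 0" "W (add_mset l \<beta>) \<noteq> 0" "size \<alpha> = size \<beta>" "count \<alpha> j < count \<beta> j"
    have "count (add_mset l \<alpha>) j < count (add_mset l \<beta>) j" using a(4) by simp
    then obtain k where k: "count (add_mset l \<beta>) k < count (add_mset l \<alpha>) k"
      "W (add_mset j (add_mset l \<alpha> - {#k#})) \<noteq> 0"
      using ex[OF a(1,2)] a(3) by (metis size_add_mset)
    have k1: "count \<beta> k < count \<alpha> k" using k(1) by (auto split: if_splits)
    then have "k \<in># \<alpha>" by (metis count_greater_zero_iff gr_zeroI not_less_zero)
    then have "add_mset j (add_mset l \<alpha> - {#k#}) = add_mset l (add_mset j (\<alpha> - {#k#}))"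
      by (simp add: add_mset_commute diff_union_swap)
    then show "\<exists>k. count \<beta> k < count \<alpha> k \<and> W (add_mset l (add_mset j (\<alpha> - {#k#}))) \<noteq> 0"
      using k k1 by metis
  next
    fix \<alpha>
    show "hyperbolic (\<lambda>i j. W (add_mset l (\<alpha> + {#i, j#})))"
      using hyp[of "add_mset l \<alpha>"] by (simp add: add_mset_commute)
  qed (use nn in auto)
qed

text \<open>Exchange \<open>j\<close> into \<alpha> at the cost of some \<open>k\<close>. If
  \<open>i\<close> survives, \<open>i\<close> and \<open>j\<close> are adjacent. If k = i, any other
  element \<open>l\<close> of \<alpha> is adjacent to \<open>i\<close> through \<alpha> and to
  \<open>j\<close> through the exchanged multiset; such an \<open>l\<close> exists because n >=
  2.\<close>

lemma exchange_connected:
  fixes W :: "'n::finite multiset \<Rightarrow> real"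
  assumes "Lorentzian W" and "W \<alpha> \<noteq> 0" "W \<beta> \<noteq> 0" "size \<alpha> = n" "size \<beta> = n" "2 \<le> n"
    and "i \<in># \<alpha>" "j \<in># \<beta>"
  defines "adj \<equiv> \<lambda>a b. \<exists>\<gamma>. size \<gamma> = n \<and> {#a, b#} \<subseteq># \<gamma> \<and> W \<gamma> \<noteq> 0"
  shows "i = j \<or> adj i j \<or> (\<exists>l. adj i l \<and> adj l j)"
proof (cases "i = j \<or> j \<in># \<alpha>")
  case True
  then show ?thesis
  proof
    assume j: "j \<in># \<alpha>"
    show ?thesis
    proof (cases "i = j")
      case False
      then have "{#i, j#} \<subseteq># \<alpha>" using j assms(7)
        by (auto simp: subseteq_mset_def Suc_le_eq)
      then show ?thesis unfolding adj_def using assms by blast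
    qed simp
  qed simp
next
  case False
  then have "count \<alpha> j = 0" "count \<beta> j > 0" using assms(8)
    by (auto simp: not_in_iff)
  then have "count \<alpha> j < count \<beta> j" by simp
  then obtain k where k: "count \<beta> k < count \<alpha> k" and W: "W (add_mset j (\<alpha> - {#k#})) \<noteq> 0"
    using assms(1-5) unfolding Lorentzian_def by metis
  then have "k \<in># \<alpha>" by (metis count_greater_zero_iff gr_zeroI not_less_zero)
  then have sz: "size (add_mset j (\<alpha> - {#k#})) = n"
    using assms(4) by (metis insert_DiffM size_add_mset)
  show ?thesis
  proof (cases "i \<in># \<alpha> - {#k#}")
    case True
    then have "{#i, j#} \<subseteq># add_mset j (\<alpha> - {#k#})"
      by (simp add: add_mset_commute)
    then show ?thesis unfolding adj_def using W sz by blast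
  next
    case False
    then have "k = i" using assms(7) by (cases "k = i") (auto simp: in_diff_count not_in_iff)
    have "size (\<alpha> - {#i#}) > 0" using assms(4,6,7)
      by (simp add: size_Diff_singleton)
    then obtain l where l: "l \<in># \<alpha> - {#i#}" by (metis multiset_nonemptyE size_empty less_irrefl)
    have "{#i, l#} \<subseteq># \<alpha>" using l assms(7)
      by (metis insert_subset_eq_iff mset_subset_eq_single)
    then have "adj i l" unfolding adj_def using assms by blast
    moreover have "{#l, j#} \<subseteq># add_mset j (\<alpha> - {#k#})" using l \<open>k = i\<close>
      by (simp add: add_mset_commute)
    then have "adj l j" unfolding adj_def using W sz by blast
    ultimately show ?thesis by blast
  qed
qed

text \<open>The induction runs over all \<open>W\<close> at once, since the forms \<open>g l\<close>
  in the Bochner step belong to the partial derivatives of \<open>W\<close>, which are Lorentzian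
  again, with one direction fewer.\<close>

lemma hyperbolic_dir_deriv_pos:
  fixes W :: "'n::finite multiset \<Rightarrow> real"
  assumes "Lorentzian W" and "\<And>v i. v \<in> set vs \<Longrightarrow> 0 < v i"
  shows "hyperbolic (\<lambda>i j. foldr dir_deriv vs W {#i, j#})"
  using assms
proof (induction vs arbitrary: W)
  case Nil
  then have "hyperbolic (\<lambda>i j. W ({#} + {#i, j#}))" unfolding Lorentzian_def by blast
  then show ?case by simp
next
  case (Cons v vs)
  define g where "g l i j = foldr dir_deriv vs W {#l, i, j#}" for l i j
  define H where "H = (\<lambda>i j. \<Sum>l\<in>UNIV. v l * g l i j)"
  have nn: "0 \<le> W \<alpha>" for \<alpha> using Cons.prems(1) unfolding Lorentzian_def by blast
  have H: "H i j = foldr dir_deriv (v # vs) W {#i, j#}" for i j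
    unfolding H_def g_def by (simp add: dir_deriv_def)
  have Hiff: "H i j \<noteq> 0 \<longleftrightarrow> (\<exists>\<gamma>. size \<gamma> = length vs + 3 \<and> {#i, j#} \<subseteq># \<gamma> \<and> W \<gamma> \<noteq> 0)" for i j
  proof -
    have "H i j \<noteq> 0 \<longleftrightarrow> (\<exists>\<gamma>. size \<gamma> = length (v # vs) \<and> W ({#i, j#} + \<gamma>) \<noteq> 0)"
      unfolding H using Cons.prems(2) nn by (intro foldr_dir_deriv_neq_0_iff)
    also have "\<dots> \<longleftrightarrow> (\<exists>\<gamma>. size \<gamma> = length vs + 3 \<and> {#i, j#} \<subseteq># \<gamma> \<and> W \<gamma> \<noteq> 0)"
    proof
      assume "\<exists>\<gamma>. size \<gamma> = length (v # vs) \<and> W ({#i, j#} + \<gamma>) \<noteq> 0"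
      then obtain \<gamma> where "size \<gamma> = length (v # vs)" "W ({#i, j#} + \<gamma>) \<noteq> 0" by blast
      then show "\<exists>\<gamma>. size \<gamma> = length vs + 3 \<and> {#i, j#} \<subseteq># \<gamma> \<and> W \<gamma> \<noteq> 0"
        by (intro exI[of _ "{#i, j#} + \<gamma>"]) simp
    next
      assume "\<exists>\<gamma>. size \<gamma> = length vs + 3 \<and> {#i, j#} \<subseteq># \<gamma> \<and> W \<gamma> \<noteq> 0"
      then obtain \<gamma> where "size ({#i, j#} + \<gamma>) = length vs + 3" "W ({#i, j#} + \<gamma>) \<noteq> 0"
        unfolding mset_subset_eq_exists_conv by blast
      then show "\<exists>\<gamma>. size \<gamma> = length (v # vs) \<and> W ({#i, j#} + \<gamma>) \<noteq> 0"
        by (intro exI[of _ \<gamma>]) simp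
    qed
    finally show ?thesis .
  qed
  have "hyperbolic (\<lambda>i j. \<Sum>l\<in>UNIV. v l * g l i j)"
  proof (rule hyperbolic_bochner)
    show "g i j l = g j i l" "g i j l = g i l j" for i j l
      unfolding g_def by (simp_all add: add_mset_commute)
    show "0 \<le> g i j l" for i j l
      unfolding g_def using Cons.prems(2) by (intro foldr_dir_deriv_nonneg nn) (auto intro: less_imp_le)
    show "0 < v i" for i using Cons.prems(2) by simp
    show "hyperbolic (g l)" for l
    proof -
      have "g l = (\<lambda>i j. foldr dir_deriv vs (\<lambda>\<alpha>. W (add_mset l \<alpha>)) {#i, j#})"
        unfolding g_def foldr_dir_deriv_add_mset by blast
      then show ?thesis
        using Cons.IH[OF Lorentzian_add_mset[OF Cons.prems(1)], of l] Cons.prems(2) by simp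
    qed
    show "i = j \<or> (\<Sum>l\<in>UNIV. v l * g l i j) \<noteq> 0 \<or>
        (\<exists>k. (\<Sum>l\<in>UNIV. v l * g l i k) \<noteq> 0 \<and> (\<Sum>l\<in>UNIV. v l * g l k j) \<noteq> 0)"
      if ia: "(\<Sum>l\<in>UNIV. v l * g l i a) \<noteq> 0" and jb: "(\<Sum>l\<in>UNIV. v l * g l j b) \<noteq> 0" for i j a b
    proof -
      obtain \<alpha> where \<alpha>: "size \<alpha> = length vs + 3" "{#i, a#} \<subseteq># \<alpha>" "W \<alpha> \<noteq> 0"
        using ia Hiff[of i a] unfolding H_def by blast
      obtain \<beta> where \<beta>: "size \<beta> = length vs + 3" "{#j, b#} \<subseteq># \<beta>" "W \<beta> \<noteq> 0"
        using jb Hiff[of j b] unfolding H_def by blast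
      have "i \<in># \<alpha>" "j \<in># \<beta>" using \<alpha>(2) \<beta>(2) by (auto dest: mset_subset_eqD)
      then have "i = j \<or> H i j \<noteq> 0 \<or> (\<exists>l. H i l \<noteq> 0 \<and> H l j \<noteq> 0)"
        unfolding Hiff using \<alpha> \<beta> by (intro exchange_connected[OF Cons.prems(1)]) auto
      then show ?thesis unfolding H_def .
    qed
  qed
  then show ?case unfolding H_def[symmetric] H .
qed

text \<open>Shift all directions by e > 0 to make them positive and let e tend to 0: the values
  depend continuously on e, and the inequality is closed.\<close>

lemma hyperbolic_dir_deriv:
  fixes W :: "'n::finite multiset \<Rightarrow> real"
  assumes W: "Lorentzian W" and vs: "\<And>v i. v \<in> set vs \<Longrightarrow> 0 \<le> v i"
  shows "hyperbolic (\<lambda>i j. foldr dir_deriv vs W {#i, j#})"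
  unfolding hyperbolic_def
proof (intro allI impI)
  fix x u :: "'n \<Rightarrow> real" assume u: "\<forall>i. 0 \<le> u i"
  define G where "G e \<alpha> = foldr dir_deriv (map (\<lambda>v i. v i + e) vs) W \<alpha>" for e :: real and \<alpha>
  have lim: "((\<lambda>e. G e \<alpha>) \<longlongrightarrow> foldr dir_deriv vs W \<alpha>) (at_right 0)" for \<alpha>
    unfolding G_def
    by (induction vs arbitrary: \<alpha>) (auto simp: dir_deriv_def intro!: tendsto_eq_intros)
  have ev: "\<forall>\<^sub>F e in at_right 0. bform (\<lambda>i j. G e {#i, j#}) x x * bform (\<lambda>i j. G e {#i, j#}) u u
      \<le> (bform (\<lambda>i j. G e {#i, j#}) x u)\<^sup>2"
  proof (rule eventually_at_right_less[THEN eventually_mono])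
    fix e :: real assume "0 < e"
    then have "hyperbolic (\<lambda>i j. G e {#i, j#})"
      unfolding G_def using vs by (intro hyperbolic_dir_deriv_pos W) (auto intro: add_nonneg_pos)
    then show "bform (\<lambda>i j. G e {#i, j#}) x x * bform (\<lambda>i j. G e {#i, j#}) u u
      \<le> (bform (\<lambda>i j. G e {#i, j#}) x u)\<^sup>2"
      using u unfolding hyperbolic_def by blast
  qed
  show "bform (\<lambda>i j. foldr dir_deriv vs W {#i, j#}) x x * bform (\<lambda>i j. foldr dir_deriv vs W {#i, j#}) u u
      \<le> (bform (\<lambda>i j. foldr dir_deriv vs W {#i, j#}) x u)\<^sup>2"
    by (rule tendsto_le[OF _ _ _ ev]) (auto simp: bform_def intro!: tendsto_intros lim)
qed

section \<open>Ultrametric matrices\<close>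

lemma sum_square_split:
  fixes s t :: real
  assumes "0 < a" "0 < b"
  shows "(s + t)\<^sup>2 / (a + b) \<le> s\<^sup>2 / a + t\<^sup>2 / b"
proof -
  have "s\<^sup>2 / a + t\<^sup>2 / b - (s + t)\<^sup>2 / (a + b) = (b * s - a * t)\<^sup>2 / (a * b * (a + b))"
    using assms by (simp add: divide_simps) (simp add: algebra_simps power2_eq_square)
  also have "\<dots> \<ge> 0" using assms by simp
  finally show ?thesis by simp
qed

lemma sum_symmetric_split:
  fixes f :: "'a \<Rightarrow> 'a \<Rightarrow> real"
  assumes "finite V" "C \<subseteq> V" and sym: "\<And>i j. i \<in> V \<Longrightarrow> j \<in> V \<Longrightarrow> f i j = f j i"
  shows "(\<Sum>i\<in>V. \<Sum>j\<in>V. f i j)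
    = (\<Sum>i\<in>C. \<Sum>j\<in>C. f i j) + (\<Sum>i\<in>V - C. \<Sum>j\<in>V - C. f i j) + 2 * (\<Sum>i\<in>V - C. \<Sum>j\<in>C. f i j)"
proof -
  have s: "sum g V = sum g C + sum g (V - C)" for g :: "'a \<Rightarrow> real"
    using assms(1,2) by (simp add: sum.subset_diff)
  have "(\<Sum>i\<in>C. \<Sum>j\<in>V - C. f i j) = (\<Sum>j\<in>V - C. \<Sum>i\<in>C. f i j)" by (rule sum.swap)
  also have "\<dots> = (\<Sum>i\<in>V - C. \<Sum>j\<in>C. f i j)"
    using assms(2) by (intro sum.cong refl sym) auto
  finally show ?thesis by (simp add: s sum.distrib)
qed

text \<open>At the largest distance K > 0 the points split into two nonempty classes with all cross
  distances equal to K, so the matrix K - p is block diagonal and induction applies to the blocks.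
  The factor M / |V| is sharp: equality holds for p = M off the diagonal and constant
  \<open>y\<close>.\<close>

lemma ultrametric_form_ge:
  fixes p :: "'a \<Rightarrow> 'a \<Rightarrow> real" and y :: "'a \<Rightarrow> real"
  assumes "finite V"
    and "\<And>i j. i \<in> V \<Longrightarrow> j \<in> V \<Longrightarrow> p i j = p j i"
    and "\<And>i. i \<in> V \<Longrightarrow> p i i = 0"
    and "\<And>i j. i \<in> V \<Longrightarrow> j \<in> V \<Longrightarrow> 0 \<le> p i j"
    and "\<And>i j k. i \<in> V \<Longrightarrow> j \<in> V \<Longrightarrow> k \<in> V \<Longrightarrow> p i j \<le> max (p i k) (p k j)"
    and "\<And>i j. i \<in> V \<Longrightarrow> j \<in> V \<Longrightarrow> p i j \<le> M" and "0 \<le> M"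
  shows "M / card V * (\<Sum>i\<in>V. y i)\<^sup>2 \<le> (\<Sum>i\<in>V. \<Sum>j\<in>V. (M - p i j) * y i * y j)"
  using assms
proof (induction "card V" arbitrary: V M rule: less_induct)
  case less
  have square: "(\<Sum>i\<in>A. \<Sum>j\<in>A. c * y i * y j) = c * (\<Sum>i\<in>A. y i)\<^sup>2" for c A
    unfolding power2_eq_square sum_product by (simp add: sum_distrib_left mult.assoc)
  show ?case
  proof (cases "V = {}")
    case True
    then show ?thesis by simp
  next
    case False
    define K where "K = Max ((\<lambda>(i, j). p i j) ` (V \<times> V))"
    have fin: "finite ((\<lambda>(i, j). p i j) ` (V \<times> V))" using less.prems(1) by simp
    have K_ge: "p i j \<le> K" if "i \<in> V" "j \<in> V" for i j
      unfolding K_def using fin that by (intro Max_ge) auto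
    have "K \<in> (\<lambda>(i, j). p i j) ` (V \<times> V)"
      unfolding K_def using fin False by (intro Max_in) auto
    then obtain a b where ab: "a \<in> V" "b \<in> V" "p a b = K" by auto
    have "K \<ge> 0" "K \<le> M" using ab less.prems(4,6) by auto
    have cV: "1 \<le> card V" using False less.prems(1) by (simp add: Suc_le_eq card_gt_0_iff)
    have main: "K / card V * (\<Sum>i\<in>V. y i)\<^sup>2 \<le> (\<Sum>i\<in>V. \<Sum>j\<in>V. (K - p i j) * y i * y j)"
    proof (cases "K = 0")
      case True
      then have "p i j = 0" if "i \<in> V" "j \<in> V" for i j
        using K_ge[OF that] less.prems(4)[OF that] by simp
      then show ?thesis using True by simp
    next
      case False
      then have "K > 0" using \<open>K \<ge> 0\<close> by simp
      \<comment> \<open>The open ball of radius K around an endpoint of a pair at maximal distance;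
        the other endpoint lies outside it.\<close>
      define C where "C = {j \<in> V. p a j < K}"
      define D where "D = V - C"
      have aC: "a \<in> C" "b \<in> D" unfolding C_def D_def using ab \<open>K > 0\<close> less.prems(3) by auto
      have sub: "C \<subseteq> V" "D \<subseteq> V" unfolding C_def D_def by auto
      have fins: "finite C" "finite D" using sub less.prems(1) finite_subset by auto
      have card: "card V = card C + card D"
        unfolding D_def using sub fins less.prems(1) by (simp add: card_Diff_subset card_mono)
      have pos: "card C > 0" "card D > 0" using aC fins card_gt_0_iff by blast+
      have cross: "p i j = K" if "i \<in> D" "j \<in> C" for i j
      proof -
        have ij: "i \<in> V" "j \<in> V" using that sub by auto
        have "p a i = K" using that(1) K_ge[OF ab(1) ij(1)] unfolding C_def D_def by auto
        moreover have "p a j < K" using that(2) unfolding C_def by simp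
        ultimately have "K \<le> p j i" using less.prems(5)[OF ab(1) ij(1) ij(2)] by auto
        then show ?thesis using K_ge[OF ij] less.prems(2)[OF ij] by simp
      qed
      have IH: "K / card A * (\<Sum>i\<in>A. y i)\<^sup>2 \<le> (\<Sum>i\<in>A. \<Sum>j\<in>A. (K - p i j) * y i * y j)"
        if "A \<subseteq> V" "card A < card V" for A
        using that less.prems(2-5) K_ge \<open>K \<ge> 0\<close> finite_subset[OF that(1) less.prems(1)]
        by (intro less.hyps) (auto simp: subset_iff)
      have "(\<Sum>i\<in>V. y i) = (\<Sum>i\<in>C. y i) + (\<Sum>i\<in>D. y i)"
        unfolding D_def using less.prems(1) sub by (simp add: sum.subset_diff)
      then have "K / card V * (\<Sum>i\<in>V. y i)\<^sup>2
          = K * (((\<Sum>i\<in>C. y i) + (\<Sum>i\<in>D. y i))\<^sup>2 / (real (card C) + real (card D)))"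
        unfolding card by simp
      also have "\<dots> \<le> K * ((\<Sum>i\<in>C. y i)\<^sup>2 / card C + (\<Sum>i\<in>D. y i)\<^sup>2 / card D)"
        using pos \<open>K \<ge> 0\<close> by (intro mult_left_mono sum_square_split) auto
      also have "\<dots> = K / card C * (\<Sum>i\<in>C. y i)\<^sup>2 + K / card D * (\<Sum>i\<in>D. y i)\<^sup>2"
        by (simp add: distrib_left)
      also have "\<dots> \<le> (\<Sum>i\<in>C. \<Sum>j\<in>C. (K - p i j) * y i * y j) + (\<Sum>i\<in>D. \<Sum>j\<in>D. (K - p i j) * y i * y j)"
        using sub card pos by (intro add_mono IH) auto
      also have "\<dots> = (\<Sum>i\<in>V. \<Sum>j\<in>V. (K - p i j) * y i * y j)"
      proof -
        have "(\<Sum>i\<in>D. \<Sum>j\<in>C. (K - p i j) * y i * y j) = 0"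
          using cross by (simp add: sum.neutral)
        moreover have "(K - p i j) * y i * y j = (K - p j i) * y j * y i" if "i \<in> V" "j \<in> V" for i j
          using less.prems(2)[OF that] by simp
        ultimately show ?thesis
          using sum_symmetric_split[of V C "\<lambda>i j. (K - p i j) * y i * y j"] less.prems(1) sub
          unfolding D_def by simp
      qed
      finally show ?thesis .
    qed
    \<comment> \<open>Raising K to M adds (M - K) times the square of the sum on the right, which
      more than pays for the gain on the left since |V| >= 1.\<close>
    have "M / card V * (\<Sum>i\<in>V. y i)\<^sup>2
        = (M - K) / card V * (\<Sum>i\<in>V. y i)\<^sup>2 + K / card V * (\<Sum>i\<in>V. y i)\<^sup>2"
      by (simp add: diff_divide_distrib algebra_simps)
    also have "\<dots> \<le> (M - K) * (\<Sum>i\<in>V. y i)\<^sup>2 + (\<Sum>i\<in>V. \<Sum>j\<in>V. (K - p i j) * y i * y j)"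
    proof (intro add_mono main mult_right_mono)
      show "(M - K) / card V \<le> M - K"
        using cV \<open>K \<le> M\<close> mult_left_mono[of 1 "real (card V)" "M - K"] by (simp add: divide_le_eq)
    qed simp
    also have "\<dots> = (\<Sum>i\<in>V. \<Sum>j\<in>V. (M - K) * y i * y j) + (\<Sum>i\<in>V. \<Sum>j\<in>V. (K - p i j) * y i * y j)"
      by (simp add: square)
    also have "\<dots> = (\<Sum>i\<in>V. \<Sum>j\<in>V. (M - p i j) * y i * y j)"
      unfolding sum.distrib[symmetric] by (intro sum.cong refl) (simp add: algebra_simps)
    finally show ?thesis .
  qed
qed

text \<open>The square is completed in x_e, that is, on the hyperplane where the derivative in
  direction \<open>e\<close> vanishes. With y_i = Q_ie x_i the remaining form has matrix p_ij = Q_ij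
  / (Q_ie Q_je), and \<open>ultra\<close> divided by Q_ie Q_je Q_ke is the ultrametric inequality
  for p. \<open>bound\<close> says p <= N / ((N - 1) Q_ee), and the factor 1 - 1/N gained from the
  ultrametric estimate reduces this to 1 / Q_ee, the coefficient that completing the square
  subtracts.\<close>

lemma hyperbolic_ultrametric:
  fixes Q :: "'n::finite \<Rightarrow> 'n \<Rightarrow> real" and e :: 'n and N :: nat
  assumes sym: "\<And>i j. Q i j = Q j i" and nonneg: "\<And>i j. 0 \<le> Q i j"
    and diag: "\<And>i. i \<noteq> e \<Longrightarrow> Q i i = 0"
    and ultra: "\<And>i j k. i \<noteq> e \<Longrightarrow> j \<noteq> e \<Longrightarrow> k \<noteq> e \<Longrightarrow> i \<noteq> j \<Longrightarrow> i \<noteq> k \<Longrightarrow> j \<noteq> k \<Longrightarrow>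
        Q i j * Q k e \<le> max (Q i k * Q j e) (Q j k * Q i e)"
    and ne: "Q k0 e \<noteq> 0"
    and N: "card {i. i \<noteq> e \<and> Q i e \<noteq> 0} \<le> N" "2 \<le> N"
    and bound: "\<And>i j. i \<noteq> e \<Longrightarrow> j \<noteq> e \<Longrightarrow> real (N - 1) * Q e e * Q i j \<le> real N * Q i e * Q j e"
  shows "hyperbolic Q"
proof (rule hyperbolicI[where l = "\<lambda>i. Q i e"])
  fix x :: "'n \<Rightarrow> real"
  assume x: "(\<Sum>i\<in>UNIV. Q i e * x i) = 0"
  define V where "V = {i. i \<noteq> e \<and> Q i e \<noteq> 0}"
  define y where "y i = Q i e * x i" for i
  define p where "p i j = Q i j / (Q i e * Q j e)" for i j
  define a where "a = Q e e"
  define \<sigma> where "\<sigma> = (\<Sum>i\<in>V. y i)"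
  have Vpos: "Q i e > 0" if "i \<in> V" for i
    using that nonneg[of i e] unfolding V_def by auto
  have Ve: "i \<noteq> e" if "i \<in> V" for i using that unfolding V_def by auto
  have a0: "a \<ge> 0" unfolding a_def by (rule nonneg)
  have bound0: "Q i j = 0" if "i \<noteq> e" "j \<noteq> e" "a > 0" "Q i e = 0" for i j
    using bound[OF that(1,2)] that(3,4) N(2) nonneg[of i j] unfolding a_def
    by (auto simp: mult_le_0_iff)
  have sum_e: "(\<Sum>i\<in>- {e}. y i) = \<sigma>"
    unfolding \<sigma>_def V_def y_def by (intro sum.mono_neutral_right) auto
  have "(\<Sum>i\<in>UNIV. y i) = y e + (\<Sum>i\<in>- {e}. y i)"
    by (simp add: sum.remove[of UNIV e] Compl_eq_Diff_UNIV)
  then have \<sigma>: "a * x e + \<sigma> = 0"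
    using x unfolding sum_e by (simp add: y_def a_def)
  have V_sum: "(\<Sum>i\<in>V. \<Sum>j\<in>V. Q i j * x i * x j) \<le> M * (1 - 1 / N) * \<sigma>\<^sup>2"
    if M: "0 \<le> M" "\<And>i j. i \<in> V \<Longrightarrow> j \<in> V \<Longrightarrow> p i j \<le> M" for M
  proof -
    have "M / card V * (\<Sum>i\<in>V. y i)\<^sup>2 \<le> (\<Sum>i\<in>V. \<Sum>j\<in>V. (M - p i j) * y i * y j)"
    proof (rule ultrametric_form_ge)
      show p0: "0 \<le> p i j" for i j unfolding p_def using nonneg by simp
      show pi: "p i i = 0" if "i \<in> V" for i unfolding p_def using diag[OF Ve[OF that]] by simp
      show ps: "p i j = p j i" for i j unfolding p_def using sym[of i j] by (simp add: mult.commute)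
      show "p i j \<le> max (p i k) (p k j)" if "i \<in> V" "j \<in> V" "k \<in> V" for i j k
      proof (cases "i = j \<or> i = k \<or> j = k")
        case True
        then show ?thesis using pi p0 that by (auto simp: le_max_iff_disj)
      next
        case False
        have pos: "Q i e > 0" "Q j e > 0" "Q k e > 0" using Vpos that by auto
        have "Q i j * Q k e \<le> Q i k * Q j e \<or> Q i j * Q k e \<le> Q j k * Q i e"
          using ultra[of i j k] Ve that False by (auto simp: le_max_iff_disj)
        then have "p i j \<le> p i k \<or> p i j \<le> p k j"
          unfolding p_def sym[of k j] using pos by (auto simp: field_simps)
        then show ?thesis by (auto simp: le_max_iff_disj)
      qed
    qed (use M in auto)
    also have "\<dots> = (\<Sum>i\<in>V. \<Sum>j\<in>V. M * (y i * y j) - Q i j * x i * x j)"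
      unfolding p_def y_def
      by (intro sum.cong refl) (use Vpos in \<open>force simp: field_simps\<close>)
    also have "\<dots> = M * \<sigma>\<^sup>2 - (\<Sum>i\<in>V. \<Sum>j\<in>V. Q i j * x i * x j)"
      unfolding \<sigma>_def power2_eq_square sum_product by (simp add: sum_subtractf sum_distrib_left)
    finally have le: "(\<Sum>i\<in>V. \<Sum>j\<in>V. Q i j * x i * x j) \<le> M * \<sigma>\<^sup>2 - M / card V * \<sigma>\<^sup>2"
      unfolding \<sigma>_def by linarith
    show ?thesis
    proof (cases "V = {}")
      case True
      then show ?thesis unfolding \<sigma>_def by simp
    next
      case False
      then have "card V > 0" by (simp add: card_gt_0_iff)
      then have "1 / N \<le> 1 / card V"
        using N(1) unfolding V_def[symmetric] by (intro frac_le) auto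
      then have "M * \<sigma>\<^sup>2 * (1 / N) \<le> M * \<sigma>\<^sup>2 * (1 / card V)" using M(1) by (intro mult_left_mono) auto
      then show ?thesis using le by (simp add: algebra_simps)
    qed
  qed
  \<comment> \<open>Variables with Q_ie = 0 have no finite p. For a > 0, \<open>bound\<close>
    removes their entries; for a = 0, comparison with \<open>k0\<close> in \<open>ultra\<close>
    removes those among themselves.\<close>
  have U_sum: "(\<Sum>i\<in>- {e} - V. \<Sum>j\<in>- {e} - V. Q i j * x i * x j) = 0"
  proof (intro sum.neutral ballI)
    fix i j assume "i \<in> - {e} - V" "j \<in> - {e} - V"
    then have ij: "i \<noteq> e" "j \<noteq> e" "Q i e = 0" "Q j e = 0" unfolding V_def by auto
    have "Q i j = 0"
    proof (cases "a > 0 \<or> i = j")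
      case True
      then show ?thesis using bound0 diag ij by auto
    next
      case False
      then have "k0 \<noteq> e" "k0 \<noteq> i" "k0 \<noteq> j" using ne ij a0 unfolding a_def by auto
      then have "Q i j * Q k0 e \<le> 0" using ultra[of i j k0] ij False by simp
      then show ?thesis using ne nonneg[of k0 e] nonneg[of i j] by (auto simp: mult_le_0_iff)
    qed
    then show "Q i j * x i * x j = 0" by simp
  qed
  have UV_sum: "(\<Sum>i\<in>- {e} - V. \<Sum>j\<in>V. Q i j * x i * x j) = 0"
  proof (rule sum.neutral, rule ballI)
    fix i assume "i \<in> - {e} - V"
    then have i: "i \<noteq> e" "Q i e = 0" unfolding V_def by auto
    show "(\<Sum>j\<in>V. Q i j * x i * x j) = 0"
    proof (cases "a > 0 \<or> V = {}")
      case True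
      then show ?thesis using bound0[of i] i Ve by (auto intro!: sum.neutral)
    next
      case False
      then obtain j0 where j0: "j0 \<in> V" by blast
      have "\<sigma> = 0" using False \<sigma> a0 by auto
      \<comment> \<open>Used with \<open>j\<close> and \<open>k\<close> in both orders, this makes
        the row of \<open>i\<close> proportional to the row of \<open>e\<close> on \<open>V\<close>,
        so its sum is a multiple of \<sigma> = 0.\<close>
      have le: "Q i j * Q k e \<le> Q i k * Q j e" if "j \<in> V" "k \<in> V" for j k
      proof (cases "j = k")
        case False
        have "i \<noteq> j" "i \<noteq> k" using i that unfolding V_def by auto
        moreover have "0 \<le> Q i k * Q j e" using nonneg by simp
        ultimately show ?thesis using ultra[of i j k] i Ve that False by auto
      qed simp
      have "Q i j = Q i j0 / Q j0 e * Q j e" if "j \<in> V" for j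
        using le[OF that j0] le[OF j0 that] Vpos[OF j0] by (simp add: field_simps)
      then have "(\<Sum>j\<in>V. Q i j * x i * x j) = (\<Sum>j\<in>V. x i * (Q i j0 / Q j0 e) * y j)"
        unfolding y_def by (intro sum.cong refl) simp
      also have "\<dots> = x i * (Q i j0 / Q j0 e) * \<sigma>" unfolding \<sigma>_def sum_distrib_left ..
      finally show ?thesis using \<open>\<sigma> = 0\<close> by simp
    qed
  qed
  have symx: "Q i j * x i * x j = Q j i * x j * x i" for i j
    using sym[of i j] by simp
  have "bform Q x x = (\<Sum>i\<in>- {e}. \<Sum>j\<in>- {e}. Q i j * x i * x j)
      + (\<Sum>i\<in>UNIV - - {e}. \<Sum>j\<in>UNIV - - {e}. Q i j * x i * x j)
      + 2 * (\<Sum>i\<in>UNIV - - {e}. \<Sum>j\<in>- {e}. Q i j * x i * x j)"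
    unfolding bform_def by (intro sum_symmetric_split) (auto simp: symx)
  also have "UNIV - - {e} = {e}" by auto
  also have "(\<Sum>i\<in>{e}. \<Sum>j\<in>- {e}. Q i j * x i * x j) = x e * (\<Sum>j\<in>- {e}. y j)"
    unfolding y_def by (simp add: sum_distrib_left sym[of e] algebra_simps)
  also have "(\<Sum>i\<in>- {e}. \<Sum>j\<in>- {e}. Q i j * x i * x j) = (\<Sum>i\<in>V. \<Sum>j\<in>V. Q i j * x i * x j)"
    using sum_symmetric_split[of "- {e}" V "\<lambda>i j. Q i j * x i * x j"] symx U_sum UV_sum
    by (auto simp: V_def)
  finally have B: "bform Q x x = (\<Sum>i\<in>V. \<Sum>j\<in>V. Q i j * x i * x j) + a * (x e)\<^sup>2 + 2 * (x e * \<sigma>)"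
    unfolding sum_e by (simp add: a_def power2_eq_square)
  show "bform Q x x \<le> 0"
  proof (cases "a = 0")
    case True
    then have "\<sigma> = 0" using \<sigma> by simp
    define M where "M = (\<Sum>i\<in>V. \<Sum>j\<in>V. p i j)"
    have p0: "0 \<le> p i j" for i j unfolding p_def using nonneg by simp
    have "p i j \<le> M" if "i \<in> V" "j \<in> V" for i j
    proof -
      have "p i j \<le> (\<Sum>j\<in>V. p i j)" using that p0 by (intro member_le_sum) auto
      also have "\<dots> \<le> M" unfolding M_def using that p0
        by (intro member_le_sum[of i V "\<lambda>i. \<Sum>j\<in>V. p i j"]) (auto intro: sum_nonneg)
      finally show ?thesis .
    qed
    moreover have "0 \<le> M" unfolding M_def using p0 by (intro sum_nonneg) auto
    ultimately show ?thesis using V_sum[of M] B True \<open>\<sigma> = 0\<close> by simp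
  next
    case False
    then have "a > 0" using a0 by simp
    have xe: "x e = - \<sigma> / a" using \<sigma> \<open>a > 0\<close> by (simp add: field_simps)
    \<comment> \<open>Chosen so that M (1 - 1/N) = 1/a, which cancels the term -\<sigma>^2 / a
      coming from x_e = -\<sigma> / a.\<close>
    define M where "M = N / (real (N - 1) * a)"
    have N1: "real (N - 1) > 0" using N(2) by simp
    have "p i j \<le> M" if "i \<in> V" "j \<in> V" for i j
      using bound[OF Ve[OF that(1)] Ve[OF that(2)]] Vpos[OF that(1)] Vpos[OF that(2)] N1 \<open>a > 0\<close>
      unfolding p_def M_def a_def[symmetric] by (simp add: divide_simps mult_ac)
    moreover have "0 \<le> M" unfolding M_def using \<open>a > 0\<close> by simp
    ultimately have "(\<Sum>i\<in>V. \<Sum>j\<in>V. Q i j * x i * x j) \<le> M * (1 - 1 / N) * \<sigma>\<^sup>2"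
      by (intro V_sum)
    also have "M * (1 - 1 / N) = 1 / a"
      unfolding M_def using N(2) N1 \<open>a > 0\<close> by (simp add: of_nat_diff divide_simps)
    finally show ?thesis unfolding B xe using \<open>a > 0\<close> by (simp add: power2_eq_square field_simps)
  qed
qed (use sym nonneg in auto)

section \<open>The homogenised polynomial of an exchange weight\<close>

text \<open>M-natural-concavity of log w, with w = 0 where the logarithm would be minus
  infinity.\<close>

definition mult_exchange :: "('e set \<Rightarrow> real) \<Rightarrow> bool" where
  "mult_exchange w \<longleftrightarrow> (\<forall>S. 0 \<le> w S) \<and>
     (\<forall>S T i. i \<in> S - T \<longrightarrow>
        w S * w T \<le> w (S - {i}) * w (insert i T) \<or>
        (\<exists>j\<in>T - S. w S * w T \<le> w (insert j (S - {i})) * w (insert i (T - {j}))))"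

text \<open>The variable z of the homogenisation is None, and x_i is Some i.\<close>

definition hom_weight :: "('e::finite set \<Rightarrow> real) \<Rightarrow> nat \<Rightarrow> 'e option multiset \<Rightarrow> real" where
  "hom_weight w n \<alpha> =
     (if size \<alpha> = n \<and> (\<forall>i. count \<alpha> (Some i) \<le> 1)
      then w {i. Some i \<in># \<alpha>} * fact (count \<alpha> None) else 0)"

lemma mult_exchange_nonneg: "mult_exchange w \<Longrightarrow> 0 \<le> w S"
  unfolding mult_exchange_def by blast

lemma mult_exchangeD:
  assumes "mult_exchange w" "i \<in> S" "i \<notin> T"
  obtains "w S * w T \<le> w (S - {i}) * w (insert i T)"
  | j where "j \<in> T" "j \<notin> S" "w S * w T \<le> w (insert j (S - {i})) * w (insert i (T - {j}))"
  using assms unfolding mult_exchange_def by blast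

section \<open>Supports of exchange weights\<close>

lemma mult_exchange_support:
  assumes "mult_exchange w" "w S \<noteq> 0" "w T \<noteq> 0" "i \<in> S" "i \<notin> T"
  obtains "w (S - {i}) \<noteq> 0" "w (insert i T) \<noteq> 0"
  | j where "j \<in> T" "j \<notin> S" "w (insert j (S - {i})) \<noteq> 0" "w (insert i (T - {j})) \<noteq> 0"
proof -
  have pos: "w S * w T > 0"
    using assms(2,3) mult_exchange_nonneg[OF assms(1)] by (simp add: order_less_le)
  show ?thesis
    using mult_exchangeD[OF assms(1,4,5)]
  proof cases
    case 1
    then have "w (S - {i}) * w (insert i T) \<noteq> 0" using pos by linarith
    then show ?thesis using that(1) by simp
  next
    case (2 j)
    then have "w (insert j (S - {i})) * w (insert i (T - {j})) \<noteq> 0" using pos by linarith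
    then show ?thesis using that(2) 2 by simp
  qed
qed

text \<open>Exchange an element of S - T out of \<open>S\<close>. Either it leaves alone, or
  \<open>T\<close> trades an element for it and comes closer to \<open>S\<close> without changing
  size, so |T - S| drops.\<close>

lemma mult_exchange_delete:
  fixes S T :: "'e::finite set"
  assumes w: "mult_exchange w" and "w S \<noteq> 0" "w T \<noteq> 0" "card T < card S"
  shows "\<exists>k. k \<in> S \<and> k \<notin> T \<and> w (S - {k}) \<noteq> 0"
  using assms(3,4)
proof (induction "card (T - S)" arbitrary: T rule: less_induct)
  case less
  obtain k where k: "k \<in> S" "k \<notin> T"
    using less.prems(2) by (metis card_mono finite leD subsetI)
  show ?case using w \<open>w S \<noteq> 0\<close> less.prems(1) k
  proof (cases rule: mult_exchange_support)
    case 1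
    then show ?thesis using k by blast
  next
    case (2 j)
    have "card (insert k (T - {j})) = card T" using k 2 card_Suc_Diff1[of T j] by simp
    moreover have "insert k (T - {j}) - S \<subset> T - S" using k 2 by auto
    then have "card (insert k (T - {j}) - S) < card (T - S)" by (intro psubset_card_mono) auto
    ultimately obtain k' where "k' \<in> S" "k' \<notin> insert k (T - {j})" "w (S - {k'}) \<noteq> 0"
      using less.hyps[of "insert k (T - {j})"] 2 less.prems(2) by auto
    then show ?thesis using 2 by auto
  qed
qed

text \<open>If exchanging \<open>t\<close> merely adds it to \<open>S\<close>, exchange some
  \<open>k\<close> of S - T between \<open>insert t S\<close> and \<open>T\<close>. Either
  \<open>k\<close> leaves alone, which is the swap, or \<open>T\<close> gains \<open>k\<close> for
  an element other than \<open>t\<close> and moves closer to \<open>S\<close>. The size condition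
  guarantees such a \<open>k\<close>.\<close>

lemma mult_exchange_swap:
  fixes S T :: "'e::finite set"
  assumes w: "mult_exchange w" and "w S \<noteq> 0" "w T \<noteq> 0" "card T \<le> card S" "t \<in> T" "t \<notin> S"
  shows "\<exists>k. k \<in> S \<and> k \<notin> T \<and> w (insert t (S - {k})) \<noteq> 0"
  using assms(3-5)
proof (induction "card (T - S)" arbitrary: T rule: less_induct)
  case less
  show ?case using w less.prems(1) \<open>w S \<noteq> 0\<close> less.prems(3) assms(6)
  proof (cases rule: mult_exchange_support)
    case 1
    have "\<not> S \<subseteq> T"
      using less.prems(2,3) assms(6) by (metis card_subset_eq finite card_mono le_antisym)
    then obtain k where k: "k \<in> S" "k \<notin> T" by blast
    have ne: "t \<noteq> k" using k less.prems(3) by auto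
    have "k \<in> insert t S" using k by simp
    from w 1(2) less.prems(1) this k(2) show ?thesis
    proof (cases rule: mult_exchange_support)
      case 1
      then show ?thesis using k ne by (metis insert_Diff_if singletonD)
    next
      case (2 j)
      have "card (insert k (T - {j})) = card T" using k 2 card_Suc_Diff1[of T j] by simp
      moreover have "insert k (T - {j}) - S \<subset> T - S" using k 2 by auto
      then have "card (insert k (T - {j}) - S) < card (T - S)" by (intro psubset_card_mono) auto
      moreover have "t \<in> insert k (T - {j})" using 2 less.prems(3) by auto
      ultimately obtain k' where "k' \<in> S" "k' \<notin> insert k (T - {j})" "w (insert t (S - {k'})) \<noteq> 0"
        using less.hyps[of "insert k (T - {j})"] 2 less.prems(2) by auto
      then show ?thesis using 2 by auto
    qed
  next
    case (2 j)
    then show ?thesis by blast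
  qed
qed

lemma size_option_multiset:
  fixes \<alpha> :: "'e::finite option multiset"
  assumes "\<And>i. count \<alpha> (Some i) \<le> 1"
  shows "size \<alpha> = count \<alpha> None + card {i. Some i \<in># \<alpha>}"
proof -
  have "size \<alpha> = (\<Sum>x\<in>UNIV. count \<alpha> x)"
    unfolding size_multiset_overloaded_eq
    by (rule sum.mono_neutral_left) (auto simp: not_in_iff)
  also have "\<dots> = count \<alpha> None + (\<Sum>i\<in>UNIV. count \<alpha> (Some i))"
    unfolding UNIV_option_conv by (simp add: sum.reindex)
  also have "(\<Sum>i\<in>UNIV. count \<alpha> (Some i)) = (\<Sum>i\<in>{i. Some i \<in># \<alpha>}. 1)"
  proof (rule sum.mono_neutral_cong_right)
    show "count \<alpha> (Some i) = 1" if "i \<in> {i. Some i \<in># \<alpha>}" for i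
      using assms[of i] that by (auto simp: count_greater_zero_iff[symmetric] simp del: count_greater_zero_iff)
  qed (auto simp: not_in_iff)
  finally show ?thesis by simp
qed

text \<open>The number of z's in a multiset is \<open>n\<close> minus the size of its set of
  x-variables. Gaining a z means deleting from the larger set; gaining x_t is a swap unless
  \<open>T\<close> is larger than \<open>S\<close>, and then \<alpha> has a z to spare, so adding
  \<open>t\<close> alone is also allowed.\<close>

lemma hom_weight_exchange:
  fixes w :: "'e::finite set \<Rightarrow> real"
  assumes w: "mult_exchange w" and "hom_weight w n \<alpha> \<noteq> 0" "hom_weight w n \<beta> \<noteq> 0"
    and j: "count \<alpha> j < count \<beta> j"
  shows "\<exists>k. count \<beta> k < count \<alpha> k \<and> hom_weight w n (add_mset j (\<alpha> - {#k#})) \<noteq> 0"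
proof -
  define S where "S = {i. Some i \<in># \<alpha>}"
  define T where "T = {i. Some i \<in># \<beta>}"
  have \<alpha>: "size \<alpha> = n" "\<And>i. count \<alpha> (Some i) \<le> 1" "w S \<noteq> 0"
    and \<beta>: "size \<beta> = n" "\<And>i. count \<beta> (Some i) \<le> 1" "w T \<noteq> 0"
    using assms(2,3) unfolding hom_weight_def S_def T_def by (auto split: if_splits)
  have cS: "count \<alpha> (Some i) = (if i \<in> S then 1 else 0)" for i
    using \<alpha>(2)[of i] unfolding S_def by (auto simp: not_in_iff count_greater_zero_iff[symmetric] simp del: count_greater_zero_iff)
  have cT: "count \<beta> (Some i) = (if i \<in> T then 1 else 0)" for i
    using \<beta>(2)[of i] unfolding T_def by (auto simp: not_in_iff count_greater_zero_iff[symmetric] simp del: count_greater_zero_iff)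
  have n: "n = count \<alpha> None + card S" "n = count \<beta> None + card T"
    using size_option_multiset[of \<alpha>] size_option_multiset[of \<beta>] \<alpha>(1,2) \<beta>(1,2) unfolding S_def T_def by auto
  have result: ?thesis if k: "count \<beta> k < count \<alpha> k"
    and sq: "\<And>i. count (add_mset j (\<alpha> - {#k#})) (Some i) = (if i \<in> R then 1 else 0)" and R: "w R \<noteq> 0" for k R
  proof (intro exI conjI)
    have "k \<in># \<alpha>" using k by (metis count_greater_zero_iff gr_zeroI not_less_zero)
    then have "size (add_mset j (\<alpha> - {#k#})) = n"
      using \<alpha>(1) by (metis insert_DiffM size_add_mset)
    moreover have "{i. Some i \<in># add_mset j (\<alpha> - {#k#})} = R"
      unfolding count_greater_zero_iff[symmetric] sq by simp
    ultimately show "hom_weight w n (add_mset j (\<alpha> - {#k#})) \<noteq> 0"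
      unfolding hom_weight_def sq using R by simp
  qed (rule k)
  show ?thesis
  proof (cases j)
    case None
    then have "card T < card S" using j n by simp
    then obtain k where k: "k \<in> S" "k \<notin> T" "w (S - {k}) \<noteq> 0"
      using mult_exchange_delete[OF w \<alpha>(3) \<beta>(3)] by blast
    show ?thesis
      by (rule result[of "Some k" "S - {k}"]) (use k in \<open>auto simp: None cS cT\<close>)
  next
    case (Some t)
    then have t: "t \<in> T" "t \<notin> S" using j by (auto simp: cS cT split: if_splits)
    show ?thesis
    proof (cases "card T \<le> card S")
      case True
      then obtain k where k: "k \<in> S" "k \<notin> T" "w (insert t (S - {k})) \<noteq> 0"
        using mult_exchange_swap[OF w \<alpha>(3) \<beta>(3) _ t] by blast
      show ?thesis
        by (rule result[of "Some k" "insert t (S - {k})"]) (use k t in \<open>auto simp: Some cS cT\<close>)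
    next
      case False
      show ?thesis using w \<beta>(3) \<alpha>(3) t
      proof (cases rule: mult_exchange_support)
        case 1
        show ?thesis
          by (rule result[of None "insert t S"]) (use 1 t False n in \<open>auto simp: Some cS cT\<close>)
      next
        case (2 k)
        show ?thesis
          by (rule result[of "Some k" "insert t (S - {k})"]) (use 2 t in \<open>auto simp: Some cS cT\<close>)
      qed
    qed
  qed
qed

section \<open>Second derivatives of the homogenised polynomial\<close>

lemma mult_le_max_right:
  fixes x y z c :: real
  shows "x \<le> max y z \<Longrightarrow> 0 \<le> c \<Longrightarrow> x * c \<le> max (y * c) (z * c)"
  by (auto simp: le_max_iff_disj mult_right_mono)

lemma hyperbolic_0: "(\<And>i j. Q i j = 0) \<Longrightarrow> hyperbolic Q"
  by (simp add: hyperbolic_def bform_def)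

text \<open>The exchange property on sets differing in at most four elements gives the ultrametric
  inequality. The square is completed in z where z occurs, and otherwise in an x-variable, where
  only sets of one size are left.\<close>

lemma hyperbolic_hom_weight:
  fixes w :: "'e::finite set \<Rightarrow> real"
  assumes w: "mult_exchange w" and B: "\<And>S. w S \<noteq> 0 \<Longrightarrow> S \<subseteq> B" and n: "n = card B"
  shows "hyperbolic (\<lambda>i j. hom_weight w n (\<alpha> + {#i, j#}))"
proof (cases "size \<alpha> + 2 = n \<and> (\<forall>i. count \<alpha> (Some i) \<le> 1)")
  case False
  have "hom_weight w n (\<alpha> + {#i, j#}) = 0" for i j
  proof (cases "size \<alpha> + 2 = n")
    case True
    then obtain a where "\<not> count \<alpha> (Some a) \<le> 1" using False by blast
    moreover have "count \<alpha> (Some a) \<le> count (\<alpha> + {#i, j#}) (Some a)" by simp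
    ultimately have "\<not> count (\<alpha> + {#i, j#}) (Some a) \<le> 1" by linarith
    then show ?thesis unfolding hom_weight_def by metis
  qed (simp add: hom_weight_def)
  then show ?thesis by (rule hyperbolic_0)
next
  case True
  then have size: "size \<alpha> + 2 = n" and le1: "\<And>i. count \<alpha> (Some i) \<le> 1" by auto
  define A where "A = {i. Some i \<in># \<alpha>}"
  define t where "t = count \<alpha> None"
  \<comment> \<open>This is (t + 1)!. The entries of \<open>Q\<close> carry (t + 2)!, (t + 1)! or
    t!, according to whether two, one or none of the last two variables is z.\<close>
  define K :: real where "K = real (t + 1) * fact t"
  have "K > 0" unfolding K_def by simp
  define Q where "Q i j = hom_weight w n (\<alpha> + {#i, j#})" for i j
  have wnn: "0 \<le> w S" for S by (rule mult_exchange_nonneg[OF w])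
  have cA: "count \<alpha> (Some i) = (if i \<in> A then 1 else 0)" for i
    using le1[of i] unfolding A_def by (auto simp: not_in_iff count_greater_zero_iff[symmetric] simp del: count_greater_zero_iff)
  have nA: "n = t + 2 + card A"
    using size_option_multiset[OF le1] size unfolding A_def t_def by simp
  have sym: "Q i j = Q j i" for i j
    unfolding Q_def by (simp add: add_mset_commute)
  have nonneg: "0 \<le> Q i j" for i j
    unfolding Q_def hom_weight_def using wnn by simp
  have sets: "{i. Some i \<in># \<alpha> + {#None, None#}} = A"
    "{i. Some i \<in># \<alpha> + {#Some a, None#}} = insert a A"
    "{i. Some i \<in># \<alpha> + {#Some a, Some b#}} = insert a (insert b A)" for a b
    unfolding A_def by auto
  have Q00: "Q None None = w A * (real (t + 2) * K)"
    unfolding Q_def hom_weight_def sets using size by (simp add: K_def cA t_def algebra_simps)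
  have Q1: "Q (Some a) None = (if a \<in> A then 0 else w (insert a A) * K)" for a
    unfolding K_def Q_def hom_weight_def sets using size by (auto simp: cA t_def algebra_simps)
  have Q2: "Q (Some a) (Some b) = (if a = b \<or> a \<in> A \<or> b \<in> A then 0 else w (insert a (insert b A)) * fact t)" for a b
    unfolding Q_def hom_weight_def sets using size by (auto simp: cA t_def algebra_simps)
  have diag: "Q (Some a) (Some a) = 0" for a unfolding Q2 by simp
  have "hyperbolic Q"
  proof (cases "\<exists>k. Q k None \<noteq> 0")
    case True
    then obtain k0 where k0: "Q k0 None \<noteq> 0" by blast
    \<comment> \<open>N = t + 2 serves twice: as the size of B - A, because the degree is |B|, and
      in (t + 2)! t! / ((t + 1)!)^2 = N / (N - 1), the factor allowed in
      \<open>bound\<close>.\<close>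
    show ?thesis
    proof (rule hyperbolic_ultrametric[where e = None and N = "t + 2" and ?k0.0 = k0])
      show "Q i i = 0" if "i \<noteq> None" for i using that diag by auto
      have "a \<in> B" if "w (insert a A) \<noteq> 0" for a using B[OF that] by simp
      then have "{i. i \<noteq> None \<and> Q i None \<noteq> 0} \<subseteq> Some ` (B - A)"
        using Q1 by (auto split: if_splits)
      then have "card {i. i \<noteq> None \<and> Q i None \<noteq> 0} \<le> card (Some ` (B - A))"
        by (intro card_mono) auto
      then have le: "card {i. i \<noteq> None \<and> Q i None \<noteq> 0} \<le> card (B - A)"
        by (simp add: card_image)
      show "card {i. i \<noteq> None \<and> Q i None \<noteq> 0} \<le> t + 2"
      proof (cases "A \<subseteq> B")
        case True
        then show ?thesis using le n nA by (simp add: card_Diff_subset)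
      next
        case False
        then have "w (insert a A) = 0" for a using B[of "insert a A"] by blast
        then have "i = None" if "Q i None \<noteq> 0" for i using that by (cases i) (auto simp: Q1 split: if_splits)
        then have "{i. i \<noteq> None \<and> Q i None \<noteq> 0} = {}" by blast
        then show ?thesis by (simp only: card.empty)
      qed
      show "real (t + 2 - 1) * Q None None * Q i j \<le> real (t + 2) * Q i None * Q j None"
        if ij: "i \<noteq> None" "j \<noteq> None" for i j
      proof -
        obtain a b where ab: "i = Some a" "j = Some b" using ij by auto
        show ?thesis
        proof (cases "a = b \<or> a \<in> A \<or> b \<in> A")
          case True
          then have "Q i j = 0" unfolding ab Q2 by simp
          then show ?thesis using nonneg by simp
        next
          case False
          \<comment> \<open>The second set is contained in the first, so nothing can be given in
            return for \<open>a\<close>.\<close>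
          have "w (insert a (insert b A)) * w A \<le> w (insert b A) * w (insert a A)"
          proof -
            have "a \<in> insert a (insert b A)" "a \<notin> A" using False by auto
            from w this show ?thesis
            proof (cases rule: mult_exchangeD)
              case 1
              moreover have "insert a (insert b A) - {a} = insert b A" using False by auto
              ultimately show ?thesis by simp
            qed auto
          qed
          then have "(w (insert a (insert b A)) * w A) * (real (t + 2) * K\<^sup>2)
              \<le> (w (insert b A) * w (insert a A)) * (real (t + 2) * K\<^sup>2)"
            by (intro mult_right_mono) auto
          moreover have "real (t + 2 - 1) * Q None None * Q i j
              = (w (insert a (insert b A)) * w A) * (real (t + 2) * K\<^sup>2)"
            using False unfolding ab Q2 Q00 by (simp add: K_def power2_eq_square algebra_simps)
          moreover have "real (t + 2) * Q i None * Q j None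
              = (w (insert b A) * w (insert a A)) * (real (t + 2) * K\<^sup>2)"
            using False unfolding ab Q1 by (simp add: power2_eq_square algebra_simps)
          ultimately show ?thesis by linarith
        qed
      qed
      show "Q i j * Q k None \<le> max (Q i k * Q j None) (Q j k * Q i None)"
        if d: "i \<noteq> None" "j \<noteq> None" "k \<noteq> None" "i \<noteq> j" "i \<noteq> k" "j \<noteq> k" for i j k
      proof -
        obtain a b c where abc: "i = Some a" "j = Some b" "k = Some c" using d by auto
        show ?thesis
        proof (cases "a \<in> A \<or> b \<in> A \<or> c \<in> A")
          case True
          then have z: "Q i j * Q k None = 0" unfolding abc Q2 Q1 by auto
          show ?thesis unfolding z by (intro max.coboundedI1 mult_nonneg_nonneg nonneg)
        next
          case False
          have ne: "a \<noteq> b" "a \<noteq> c" "b \<noteq> c" using d abc by auto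
          have "a \<in> insert a (insert b A)" "a \<notin> insert c A" using False ne by auto
          with w have "w (insert a (insert b A)) * w (insert c A)
            \<le> max (w (insert a (insert c A)) * w (insert b A)) (w (insert b (insert c A)) * w (insert a A))"
          proof (cases rule: mult_exchangeD)
            case 1
            moreover have "insert a (insert b A) - {a} = insert b A" using False ne by auto
            ultimately show ?thesis by (simp add: le_max_iff_disj mult.commute)
          next
            case (2 l)
            then have "l = c" by auto
            moreover have "insert a (insert b A) - {a} = insert b A" "insert c A - {c} = A" using False ne by auto
            ultimately show ?thesis using 2 by (simp add: le_max_iff_disj insert_commute)
          qed
          then have "(w (insert a (insert b A)) * w (insert c A)) * (fact t * K)
            \<le> max ((w (insert a (insert c A)) * w (insert b A)) * (fact t * K))
                ((w (insert b (insert c A)) * w (insert a A)) * (fact t * K))"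
            by (rule mult_le_max_right) (simp add: K_def)
          then show ?thesis using False ne unfolding abc Q2 Q1
            by (simp add: mult_ac)
        qed
      qed
    qed (use sym nonneg k0 in auto)
  next
    case False
    then have row0: "Q k None = 0" "Q None k = 0" for k using sym by auto
    have w1: "w (insert a A) = 0" if "a \<notin> A" for a
      using row0(1)[of "Some a"] that \<open>K > 0\<close> by (simp add: Q1)
    show ?thesis
    proof (cases "\<exists>k e. Q k e \<noteq> 0")
      case True
      then obtain k0 e where k0: "Q k0 e \<noteq> 0" by blast
      then obtain d where e: "e = Some d" using row0 by (cases e) auto
      \<comment> \<open>No z is left, so the square is completed in some x_d that occurs. There Q_dd
        = 0 and the left side of \<open>bound\<close> is 0; N need only be at least 2 and at least
        the number of variables.\<close>
      show ?thesis
      proof (rule hyperbolic_ultrametric[where e = e and N = "CARD('e option) + 2" and ?k0.0 = k0])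
        show "Q i i = 0" if "i \<noteq> e" for i using row0 diag by (cases i) auto
        show "card {i. i \<noteq> e \<and> Q i e \<noteq> 0} \<le> CARD('e option) + 2"
          by (intro trans_le_add1 card_mono) auto
        show "real (CARD('e option) + 2 - 1) * Q e e * Q i j \<le> real (CARD('e option) + 2) * Q i e * Q j e"
          if "i \<noteq> e" "j \<noteq> e" for i j
          using nonneg unfolding e diag by simp
        show "Q i j * Q k e \<le> max (Q i k * Q j e) (Q j k * Q i e)"
          if dist: "i \<noteq> e" "j \<noteq> e" "k \<noteq> e" "i \<noteq> j" "i \<noteq> k" "j \<noteq> k" for i j k
        proof (cases "Q i j * Q k e = 0")
          case z: True
          show ?thesis unfolding z by (intro max.coboundedI1 mult_nonneg_nonneg nonneg)
        next
          case False
          then obtain a b c where abc: "i = Some a" "j = Some b" "k = Some c"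
            using row0 by (cases i; cases j; cases k) auto
          have notA: "a \<notin> A" "b \<notin> A" "c \<notin> A" "d \<notin> A" using False unfolding abc e Q2 by auto
          have ne: "a \<noteq> b" "a \<noteq> c" "b \<noteq> c" "a \<noteq> d" "b \<noteq> d" "c \<noteq> d" using dist abc e by auto
          \<comment> \<open>The three-term relation of a valuated matroid. Moving \<open>a\<close>
            without return would leave \<open>insert b A\<close>, whose weight is 0 by
            \<open>w1\<close>.\<close>
          have "a \<in> insert a (insert b A)" "a \<notin> insert c (insert d A)" using notA ne by auto
          with w have "w (insert a (insert b A)) * w (insert c (insert d A))
            \<le> max (w (insert a (insert c A)) * w (insert b (insert d A))) (w (insert b (insert c A)) * w (insert a (insert d A)))"
          proof (cases rule: mult_exchangeD)
            case 1
            moreover have "insert a (insert b A) - {a} = insert b A" using notA ne by auto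
            ultimately show ?thesis 
              using w1[OF notA(2)] mult_nonneg_nonneg[OF wnn wnn, of "insert a (insert c A)" "insert b (insert d A)"]
              by simp
          next
            case (2 l)
            then have "l = c \<or> l = d" by auto
            moreover have "insert a (insert b A) - {a} = insert b A"
              "insert c (insert d A) - {c} = insert d A" "insert c (insert d A) - {d} = insert c A" using notA ne by auto
            ultimately show ?thesis
              using 2(3) insert_commute[of c b A] insert_commute[of d b A]
              by (elim disjE) (simp_all only: le_max_iff_disj mult.commute simp_thms)
          qed
          then have "(w (insert a (insert b A)) * w (insert c (insert d A))) * (fact t * fact t)
            \<le> max ((w (insert a (insert c A)) * w (insert b (insert d A))) * (fact t * fact t))
                ((w (insert b (insert c A)) * w (insert a (insert d A))) * (fact t * fact t))"
            by (rule mult_le_max_right) simp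
          then show ?thesis using notA ne unfolding abc e Q2
            by (simp add: mult_ac)
        qed
      qed (use sym nonneg k0 in auto)
    qed (auto intro: hyperbolic_0)
  qed
  then show ?thesis unfolding Q_def .
qed

section \<open>Products and balanced splits\<close>

definition lefts :: "('a + 'b) multiset \<Rightarrow> 'a multiset" where
  "lefts \<alpha> = image_mset projl (filter_mset isl \<alpha>)"

definition rights :: "('a + 'b) multiset \<Rightarrow> 'b multiset" where
  "rights \<alpha> = image_mset projr (filter_mset (\<lambda>x. \<not> isl x) \<alpha>)"

definition prod_weight :: "('a multiset \<Rightarrow> real) \<Rightarrow> ('b multiset \<Rightarrow> real) \<Rightarrow> ('a + 'b) multiset \<Rightarrow> real" where
  "prod_weight F G \<alpha> = F (lefts \<alpha>) * G (rights \<alpha>)"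

lemma lefts_rights_simps [simp]:
  "lefts {#} = {#}" "lefts (add_mset (Inl a) \<alpha>) = add_mset a (lefts \<alpha>)"
  "lefts (add_mset (Inr b) \<alpha>) = lefts \<alpha>" "lefts (\<alpha> + \<beta>) = lefts \<alpha> + lefts \<beta>"
  "rights {#} = {#}" "rights (add_mset (Inl a) \<alpha>) = rights \<alpha>"
  "rights (add_mset (Inr b) \<alpha>) = add_mset b (rights \<alpha>)" "rights (\<alpha> + \<beta>) = rights \<alpha> + rights \<beta>"
  by (simp_all add: lefts_def rights_def)

lemma count_lefts: "count (lefts \<alpha>) a = count \<alpha> (Inl a)"
proof (induction \<alpha>)
  case (add x \<alpha>)
  then show ?case by (cases x) auto
qed simp

lemma count_rights: "count (rights \<alpha>) b = count \<alpha> (Inr b)"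
proof (induction \<alpha>)
  case (add x \<alpha>)
  then show ?case by (cases x) auto
qed simp

lemma lefts_rights_diff [simp]:
  "lefts (\<alpha> - {#Inl a#}) = lefts \<alpha> - {#a#}" "lefts (\<alpha> - {#Inr b#}) = lefts \<alpha>"
  "rights (\<alpha> - {#Inl a#}) = rights \<alpha>" "rights (\<alpha> - {#Inr b#}) = rights \<alpha> - {#b#}"
  by (auto intro!: multiset_eqI simp: count_lefts count_rights)

lemma sum_UNIV_Plus:
  fixes f :: "'a::finite + 'b::finite \<Rightarrow> real"
  shows "(\<Sum>x\<in>UNIV. f x) = (\<Sum>a\<in>UNIV. f (Inl a)) + (\<Sum>b\<in>UNIV. f (Inr b))"
  using sum.Plus[of "UNIV :: 'a set" "UNIV :: 'b set" f] by (simp add: comp_def)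

lemma lefts_rights_replicate [simp]:
  "lefts (replicate_mset n (Inl a)) = replicate_mset n a" "lefts (replicate_mset n (Inr b)) = {#}"
  "rights (replicate_mset n (Inl a)) = {#}" "rights (replicate_mset n (Inr b)) = replicate_mset n b"
  by (induction n) simp_all

lemma lefts_rights_image [simp]:
  "lefts (image_mset (\<lambda>i. Inl (f i)) M) = image_mset f M" "lefts (image_mset (\<lambda>i. Inr (g i)) M) = {#}"
  "rights (image_mset (\<lambda>i. Inl (f i)) M) = {#}" "rights (image_mset (\<lambda>i. Inr (g i)) M) = image_mset g M"
  by (induction M) simp_all

text \<open>By homogeneity a second derivative has one of three shapes: a multiple of a form of
  \<open>F\<close>, a multiple of a form of \<open>G\<close>, or a product of two linear forms in
  separate variables, for which the defect in the inequality is a perfect square. An exchange takes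
  place inside one factor.\<close>

lemma Lorentzian_prod_weight:
  fixes F :: "'a::finite multiset \<Rightarrow> real" and G :: "'b::finite multiset \<Rightarrow> real"
  assumes F: "Lorentzian F" and G: "Lorentzian G"
    and hF: "\<And>\<alpha>. F \<alpha> \<noteq> 0 \<Longrightarrow> size \<alpha> = d" and hG: "\<And>\<alpha>. G \<alpha> \<noteq> 0 \<Longrightarrow> size \<alpha> = e"
  shows "Lorentzian (prod_weight F G)"
proof -
  have Fnn: "0 \<le> F \<alpha>" and Gnn: "0 \<le> G \<beta>" for \<alpha> \<beta>
    using F G unfolding Lorentzian_def by blast+
  have Fex: "\<exists>k. count \<beta> k < count \<alpha> k \<and> F (add_mset j (\<alpha> - {#k#})) \<noteq> 0"
    if "F \<alpha> \<noteq> 0" "F \<beta> \<noteq> 0" "count \<alpha> j < count \<beta> j" for \<alpha> \<beta> j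
    using F that hF unfolding Lorentzian_def by metis
  have Gex: "\<exists>k. count \<beta> k < count \<alpha> k \<and> G (add_mset j (\<alpha> - {#k#})) \<noteq> 0"
    if "G \<alpha> \<noteq> 0" "G \<beta> \<noteq> 0" "count \<alpha> j < count \<beta> j" for \<alpha> \<beta> j
    using G that hG unfolding Lorentzian_def by metis
  have Fhyp: "hyperbolic (\<lambda>i j. F (\<alpha> + {#i, j#}))" and Ghyp: "hyperbolic (\<lambda>i j. G (\<beta> + {#i, j#}))" for \<alpha> \<beta>
    using F G unfolding Lorentzian_def by blast+
  show ?thesis unfolding Lorentzian_def
  proof (intro conjI allI impI)
    show "0 \<le> prod_weight F G \<alpha>" for \<alpha>
      unfolding prod_weight_def using Fnn Gnn by simp
  next
    fix \<alpha> \<beta> :: "('a + 'b) multiset" and j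
    assume a: "prod_weight F G \<alpha> \<noteq> 0" "prod_weight F G \<beta> \<noteq> 0" "count \<alpha> j < count \<beta> j"
    then have nz: "F (lefts \<alpha>) \<noteq> 0" "G (rights \<alpha>) \<noteq> 0" "F (lefts \<beta>) \<noteq> 0" "G (rights \<beta>) \<noteq> 0"
      unfolding prod_weight_def by auto
    show "\<exists>k. count \<beta> k < count \<alpha> k \<and> prod_weight F G (add_mset j (\<alpha> - {#k#})) \<noteq> 0"
    proof (cases j)
      case (Inl i)
      then obtain k where k: "count (lefts \<beta>) k < count (lefts \<alpha>) k" "F (add_mset i (lefts \<alpha> - {#k#})) \<noteq> 0"
        using Fex[OF nz(1,3), of i] a(3) by (auto simp: count_lefts)
      show ?thesis
        by (rule exI[of _ "Inl k"]) (use k nz Inl in \<open>auto simp: prod_weight_def count_lefts\<close>)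
    next
      case (Inr i)
      then obtain k where k: "count (rights \<beta>) k < count (rights \<alpha>) k" "G (add_mset i (rights \<alpha> - {#k#})) \<noteq> 0"
        using Gex[OF nz(2,4), of i] a(3) by (auto simp: count_rights)
      show ?thesis
        by (rule exI[of _ "Inr k"]) (use k nz Inr in \<open>auto simp: prod_weight_def count_rights\<close>)
    qed
  next
    fix \<alpha> :: "('a + 'b) multiset"
    define a where "a = lefts \<alpha>"
    define b where "b = rights \<alpha>"
    define Q where "Q i j = prod_weight F G (\<alpha> + {#i, j#})" for i j
    have Q: "Q (Inl i) (Inl j) = F (a + {#i, j#}) * G b"
      "Q (Inl i) (Inr k) = F (add_mset i a) * G (add_mset k b)"
      "Q (Inr k) (Inl i) = F (add_mset i a) * G (add_mset k b)"
      "Q (Inr k) (Inr l) = F a * G (b + {#k, l#})" for i j k l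
      unfolding Q_def prod_weight_def a_def b_def by simp_all
    have bQ: "bform Q x y = (\<Sum>i\<in>UNIV. \<Sum>j\<in>UNIV. Q (Inl i) (Inl j) * x (Inl i) * y (Inl j))
        + (\<Sum>i\<in>UNIV. \<Sum>j\<in>UNIV. Q (Inl i) (Inr j) * x (Inl i) * y (Inr j))
        + (\<Sum>i\<in>UNIV. \<Sum>j\<in>UNIV. Q (Inr i) (Inl j) * x (Inr i) * y (Inl j))
        + (\<Sum>i\<in>UNIV. \<Sum>j\<in>UNIV. Q (Inr i) (Inr j) * x (Inr i) * y (Inr j))" for x y
      unfolding bform_def sum_UNIV_Plus by (simp add: sum.distrib)
    have "hyperbolic Q"
    proof (cases "G b = 0")
      case False
      then have "size b = e" by (rule hG)
      then have G0: "G (add_mset k b) = 0" "G (b + {#k, l#}) = 0" for k l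
        using hG[of "add_mset k b"] hG[of "b + {#k, l#}"] by auto
      have "bform Q x y = G b * bform (\<lambda>i j. F (a + {#i, j#})) (\<lambda>i. x (Inl i)) (\<lambda>i. y (Inl i))" for x y
        unfolding bQ unfolding Q G0 bform_def by (simp add: sum_distrib_left mult_ac)
      then show ?thesis
        using Fhyp[of a] False unfolding hyperbolic_def
        by (auto simp: power_mult_distrib power2_eq_square mult_ac intro!: mult_left_mono[of _ _ "G b * G b", unfolded mult.assoc])
    next
      case True
      show ?thesis
      proof (cases "F a = 0")
        case False
        then have "size a = d" by (rule hF)
        then have F0: "F (add_mset k a) = 0" "F (a + {#k, l#}) = 0" for k l
          using hF[of "add_mset k a"] hF[of "a + {#k, l#}"] by auto
        have "bform Q x y = F a * bform (\<lambda>i j. G (b + {#i, j#})) (\<lambda>i. x (Inr i)) (\<lambda>i. y (Inr i))" for x y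
          unfolding bQ unfolding Q F0 bform_def by (simp add: sum_distrib_left mult_ac)
        then show ?thesis
          using Ghyp[of b] False unfolding hyperbolic_def
          by (auto simp: power_mult_distrib power2_eq_square mult_ac intro!: mult_left_mono[of _ _ "F a * F a", unfolded mult.assoc])
      next
        case Fa: True
        define f where "f x = (\<Sum>i\<in>UNIV. F (add_mset i a) * x (Inl i))" for x :: "'a + 'b \<Rightarrow> real"
        define g where "g x = (\<Sum>j\<in>UNIV. G (add_mset j b) * x (Inr j))" for x :: "'a + 'b \<Rightarrow> real"
        have fg: "(\<Sum>i\<in>UNIV. \<Sum>j\<in>UNIV. F (add_mset i a) * G (add_mset j b) * x (Inl i) * y (Inr j)) = f x * g y"
          "(\<Sum>j\<in>UNIV. \<Sum>i\<in>UNIV. F (add_mset i a) * G (add_mset j b) * x (Inr j) * y (Inl i)) = g x * f y" for x y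
          unfolding f_def g_def sum_product by (simp_all add: mult_ac)
        have "bform Q x y = f x * g y + g x * f y" for x y
          unfolding bQ unfolding Q fg True \<open>F a = 0\<close> by simp
        then have "(bform Q x y)\<^sup>2 - bform Q x x * bform Q y y = (f x * g y - g x * f y)\<^sup>2" for x y
          by (simp add: power2_eq_square algebra_simps)
        then show ?thesis unfolding hyperbolic_def by (metis diff_ge_0_iff_ge zero_le_power2)
      qed
    qed
    then show "hyperbolic (\<lambda>i j. prod_weight F G (\<alpha> + {#i, j#}))" unfolding Q_def .
  qed
qed

lemma Lorentzian_hom_weight:
  fixes w :: "'e::finite set \<Rightarrow> real"
  assumes "mult_exchange w" "\<And>S. w S \<noteq> 0 \<Longrightarrow> S \<subseteq> B"
  shows "Lorentzian (hom_weight w (card B))"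
  unfolding Lorentzian_def
proof (intro conjI allI impI)
  show "0 \<le> hom_weight w (card B) \<alpha>" for \<alpha>
    unfolding hom_weight_def using mult_exchange_nonneg[OF assms(1)] by simp
  show "hyperbolic (\<lambda>i j. hom_weight w (card B) (\<alpha> + {#i, j#}))" for \<alpha>
    using assms by (rule hyperbolic_hom_weight[OF _ _ refl])
qed (rule hom_weight_exchange[OF assms(1)])

section \<open>Reverse Cauchy-Schwarz for balanced splits\<close>

definition unit_dir :: "'n \<Rightarrow> 'n \<Rightarrow> real" where
  "unit_dir p i = (if i = p then 1 else 0)"

lemma foldr_unit_dir:
  "foldr dir_deriv (replicate k (unit_dir p)) W \<alpha> = W (\<alpha> + replicate_mset k p)"
proof (induction k arbitrary: \<alpha>)
  case (Suc k)
  have "dir_deriv (unit_dir p) V \<beta> = V (add_mset p \<beta>)" for V \<beta>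
    by (simp add: dir_deriv_def unit_dir_def if_distrib[of "\<lambda>c. c * _"] cong: if_cong)
  then show ?case using Suc by simp
qed simp

text \<open>Expanding the product of the two-term derivatives: \<open>S\<close> collects the indices
  for which the first term is chosen.\<close>

lemma foldr_pair_dir:
  fixes p r :: "'e \<Rightarrow> 'n::finite"
  assumes "distinct xs" and pr: "\<And>i. p i \<noteq> r i"
  shows "foldr dir_deriv (map (\<lambda>i k. unit_dir (p i) k + unit_dir (r i) k) xs) W \<alpha>
    = (\<Sum>S\<in>Pow (set xs). W (\<alpha> + image_mset p (mset_set S) + image_mset r (mset_set (set xs - S))))"
  using assms(1)
proof (induction xs arbitrary: \<alpha>)
  case (Cons x xs)
  define R where "R \<beta> = (\<Sum>S\<in>Pow (set xs). W (\<beta> + image_mset p (mset_set S) + image_mset r (mset_set (set xs - S))))" for \<beta>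
  have x: "x \<notin> set xs" using Cons.prems by simp
  have d: "dir_deriv (\<lambda>k. unit_dir (p i) k + unit_dir (r i) k) V \<beta> = V (add_mset (p i) \<beta>) + V (add_mset (r i) \<beta>)" for V i \<beta>
    by (simp add: dir_deriv_def unit_dir_def distrib_right sum.distrib if_distrib[of "\<lambda>c. c * _"] cong: if_cong)
  have IH: "foldr dir_deriv (map (\<lambda>i k. unit_dir (p i) k + unit_dir (r i) k) xs) W \<beta> = R \<beta>" for \<beta>
    unfolding R_def using Cons by simp
  have inj: "inj_on (insert x) (Pow (set xs))" using x by (auto simp: inj_on_def)
  have "(\<Sum>S\<in>Pow (set (x # xs)). W (\<alpha> + image_mset p (mset_set S) + image_mset r (mset_set (set (x # xs) - S))))
    = (\<Sum>S\<in>Pow (set xs). W (\<alpha> + image_mset p (mset_set S) + image_mset r (mset_set (insert x (set xs) - S))))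
    + (\<Sum>S\<in>Pow (set xs). W (\<alpha> + image_mset p (mset_set (insert x S)) + image_mset r (mset_set (insert x (set xs) - insert x S))))"
    unfolding list.set Pow_insert
    by (subst sum.union_disjoint) (use x in \<open>auto simp: sum.reindex[OF inj]\<close>)
  also have "\<dots> = R (add_mset (r x) \<alpha>) + R (add_mset (p x) \<alpha>)"
  proof (rule arg_cong2[of _ _ _ _ "(+)"])
    have S: "x \<notin> S \<and> finite S \<and> insert x (set xs) - S = insert x (set xs - S) \<and>
      insert x (set xs) - insert x S = set xs - S" if "S \<in> Pow (set xs)" for S
      using that x finite_subset[of S "set xs"] by auto
    show "(\<Sum>S\<in>Pow (set xs). W (\<alpha> + image_mset p (mset_set S) + image_mset r (mset_set (insert x (set xs) - S))))
      = R (add_mset (r x) \<alpha>)"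
      unfolding R_def by (intro sum.cong refl) (use S x in simp)
    show "(\<Sum>S\<in>Pow (set xs). W (\<alpha> + image_mset p (mset_set (insert x S)) + image_mset r (mset_set (insert x (set xs) - insert x S))))
      = R (add_mset (p x) \<alpha>)"
      unfolding R_def by (intro sum.cong refl) (use S x in simp)
  qed
  finally show ?case using IH d by simp
qed simp

lemma hom_weight_replicate:
  fixes S :: "'e::finite set"
  shows "hom_weight w n (replicate_mset a None + image_mset Some (mset_set S))
    = (if a + card S = n then w S * fact a else 0)"
proof -
  have 1: "count (image_mset Some M) (Some i) = count M i" for i and M :: "'e multiset"
    by (induction M) simp_all
  have 2: "count (image_mset Some (mset_set S)) None = 0"
    by (simp add: not_in_iff[symmetric])
  have "count (mset_set S) i \<le> 1" for i by (cases "i \<in> S") simp_all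
  moreover have "{i. Some i \<in># replicate_mset a None + image_mset Some (mset_set S)} = S" by auto
  ultimately show ?thesis unfolding hom_weight_def by (simp add: 1 2)
qed

text \<open>The form left in z and u has equal diagonal entries because complementation maps splits
  of size p + 2 to splits of size p. Its reverse Cauchy-Schwarz inequality then compares two
  squares.\<close>

lemma balanced_split_ineq:
  fixes w :: "'e::finite set \<Rightarrow> real"
  assumes w: "mult_exchange w" and B: "\<And>S. w S \<noteq> 0 \<Longrightarrow> S \<subseteq> B" and cB: "card B = 2 * Suc p"
  defines "c \<equiv> \<lambda>b. \<Sum>S | S \<subseteq> B \<and> card S = b. w S * w (B - S)"
  shows "real (p + 2) * c p \<le> real (p + 1) * c (p + 1)"
proof -
  define n where "n = card B"
  define F where "F = hom_weight w n"
  define W where "W = prod_weight F F"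
  define z :: "'e option + 'e option" where "z = Inl None"
  define u :: "'e option + 'e option" where "u = Inr None"
  obtain xs where xs: "distinct xs" "set xs = B" using finite_distinct_list[of B] by auto
  define vs where "vs = map (\<lambda>i k. unit_dir (Inl (Some i)) k + unit_dir (Inr (Some i) :: 'e option + 'e option) k) xs"
  \<comment> \<open>Together 2p + |B| = 4p + 2 directions, two fewer than the degree 2n = 4p + 4 of
    the product.\<close>
  define us where "us = replicate p (unit_dir z) @ replicate p (unit_dir u) @ vs"
  have wnn: "0 \<le> w S" for S by (rule mult_exchange_nonneg[OF w])
  have cnn: "0 \<le> c b" for b unfolding c_def using wnn by (intro sum_nonneg) simp
  have F: "Lorentzian F" unfolding F_def n_def using w B by (rule Lorentzian_hom_weight)
  have "size \<alpha> = n" if "F \<alpha> \<noteq> 0" for \<alpha> using that unfolding F_def hom_weight_def by (auto split: if_splits)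
  then have W: "Lorentzian W" unfolding W_def using F by (intro Lorentzian_prod_weight)
  have lefts: "lefts (replicate_mset a z + replicate_mset b u + image_mset (\<lambda>i. Inl (Some i)) (mset_set S) + image_mset (\<lambda>i. Inr (Some i)) (mset_set T))
      = replicate_mset a None + image_mset Some (mset_set S)"
    and rights: "rights (replicate_mset a z + replicate_mset b u + image_mset (\<lambda>i. Inl (Some i)) (mset_set S) + image_mset (\<lambda>i. Inr (Some i)) (mset_set T))
      = replicate_mset b None + image_mset Some (mset_set T)" for a b and S T :: "'e set"
    by (simp_all add: z_def u_def)
  \<comment> \<open>\<open>S\<close> is the set of elements differentiated in the first factor.
    Homogeneity there forces |S| = n - a = b, and then the second factor has the right degree
    too.\<close>
  have eval: "foldr dir_deriv vs W (replicate_mset a z + replicate_mset b u) = c b * (fact a * fact b)"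
    if ab: "a + b = n" for a b
  proof -
    have "foldr dir_deriv vs W (replicate_mset a z + replicate_mset b u)
        = (\<Sum>S\<in>Pow B. W (replicate_mset a z + replicate_mset b u + image_mset (\<lambda>i. Inl (Some i)) (mset_set S)
            + image_mset (\<lambda>i. Inr (Some i)) (mset_set (B - S))))"
      unfolding vs_def using foldr_pair_dir[OF xs(1), of "\<lambda>i. Inl (Some i)" "\<lambda>i. Inr (Some i)"] xs(2) by simp
    also have "\<dots> = (\<Sum>S\<in>Pow B. if card S = b then w S * w (B - S) * (fact a * fact b) else 0)"
    proof (intro sum.cong refl)
      fix S assume S: "S \<in> Pow B"
      then have "card S + card (B - S) = n" unfolding n_def by (simp add: card_Diff_subset card_mono)
      then have "a + card S = n \<longleftrightarrow> card S = b" "b + card (B - S) = n \<longleftrightarrow> card S = b" using ab by auto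
      then show "W (replicate_mset a z + replicate_mset b u + image_mset (\<lambda>i. Inl (Some i)) (mset_set S)
            + image_mset (\<lambda>i. Inr (Some i)) (mset_set (B - S)))
        = (if card S = b then w S * w (B - S) * (fact a * fact b) else 0)"
        unfolding W_def prod_weight_def lefts rights F_def hom_weight_replicate by simp
    qed
    also have "\<dots> = (\<Sum>S | S \<subseteq> B \<and> card S = b. w S * w (B - S) * (fact a * fact b))"
      by (rule sum.mono_neutral_cong_right) auto
    finally show ?thesis unfolding c_def sum_distrib_right .
  qed
  define H where "H i j = foldr dir_deriv us W {#i, j#}" for i j
  have Hval: "H i j = foldr dir_deriv vs W ({#i, j#} + replicate_mset p z + replicate_mset p u)" for i j
    unfolding H_def us_def foldr_append foldr_unit_dir ..
  have n: "n = 2 * p + 2" unfolding n_def cB by simp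
  have Hzz: "H z z = c p * (fact (p + 2) * fact p)"
    using eval[of "p + 2" p] n unfolding Hval by simp
  have Huu: "H u u = c (p + 2) * (fact (p + 2) * fact p)"
    using eval[of p "p + 2"] n unfolding Hval by (simp add: mult.commute)
  have Hzu: "H z u = c (p + 1) * (fact (p + 1) * fact (p + 1))"
    using eval[of "p + 1" "p + 1"] n unfolding Hval by (simp add: add_mset_commute)
  have "hyperbolic H"
    unfolding H_def
  proof (rule hyperbolic_dir_deriv[OF W])
    show "0 \<le> v i" if "v \<in> set us" for v i
      using that unfolding us_def vs_def by (auto simp: unit_dir_def)
  qed
  moreover have bf: "bform H (unit_dir i) (unit_dir j) = H i j" for i j
    unfolding bform_def unit_dir_def by (simp add: if_distrib[of "\<lambda>c. _ * c"] cong: if_cong)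
  moreover have "0 \<le> unit_dir u i" for i by (simp add: unit_dir_def)
  ultimately have ineq: "H z z * H u u \<le> (H z u)\<^sup>2"
    unfolding hyperbolic_def by metis
  have compl: "c (p + 2) = c p"
    unfolding c_def
    by (rule sum.reindex_bij_witness[where i = "\<lambda>S. B - S" and j = "\<lambda>S. B - S"])
      (use cB in \<open>auto simp: double_diff card_Diff_subset finite_subset mult.commute\<close>)
  have "(c p * (fact (p + 2) * fact p))\<^sup>2 \<le> (c (p + 1) * (fact (p + 1) * fact (p + 1)))\<^sup>2"
    using ineq unfolding Hzz Huu Hzu compl by (simp add: power2_eq_square)
  then have "c p * (fact (p + 2) * fact p) \<le> c (p + 1) * (fact (p + 1) * fact (p + 1))"
    by (rule power2_le_imp_le) (use cnn in simp)
  then have "(real (p + 2) * c p) * (fact (p + 1) * fact p) \<le> (real (p + 1) * c (p + 1)) * (fact (p + 1) * fact p)"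
    by (simp add: algebra_simps)
  then show ?thesis by (simp only: mult_le_cancel_right) (simp add: not_less)
qed

section \<open>Coefficients\<close>

lemma qpow_nonneg: "0 \<le> qpow q v"
  by (simp add: qpow_def)

text \<open>For q <= 1 the function q^(-v) increases with v. If \<open>a\<close> and
  \<open>b\<close> are finite, so is a + b, which keeps \<open>c\<close> and \<open>d\<close> away
  from minus infinity; otherwise the left side is 0 by the convention.\<close>

lemma qpow_mult_mono:
  assumes "0 < q" "q \<le> 1" and le: "a + b \<le> c + d"
    and fin: "a \<noteq> \<infinity>" "b \<noteq> \<infinity>" "c \<noteq> \<infinity>" "d \<noteq> \<infinity>"
  shows "qpow q a * qpow q b \<le> qpow q c * qpow q d"
proof (cases "a = -\<infinity> \<or> b = -\<infinity>")
  case True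
  then show ?thesis using qpow_nonneg by (auto simp: qpow_def)
next
  case False
  then obtain a' b' where ab: "a = ereal a'" "b = ereal b'" using fin by (cases a; cases b) auto
  then obtain c' d' where cd: "c = ereal c'" "d = ereal d'" using fin le by (cases c; cases d) auto
  have "a' + b' \<le> c' + d'" using le ab cd by simp
  then have "q powr (- a' + - b') \<le> q powr (- c' + - d')"
    using assms(1,2) by (intro powr_mono') auto
  then show ?thesis unfolding ab cd powr_add by (simp add: qpow_def)
qed

lemma mult_exchange_qpow:
  fixes \<nu> :: "'e::finite set \<Rightarrow> ereal"
  assumes \<nu>: "Mnat_concave \<nu>" and q: "0 < q" "q \<le> 1"
  shows "mult_exchange (\<lambda>S. qpow q (\<nu> S))"
proof -
  have fin: "\<nu> S \<noteq> \<infinity>" for S using \<nu> unfolding Mnat_concave_def by blast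
  show ?thesis unfolding mult_exchange_def
  proof (intro conjI allI impI)
    fix S T :: "'e set" and i assume "i \<in> S - T"
    then have "\<nu> S + \<nu> T \<le> \<nu> (S - {i}) + \<nu> (insert i T) \<or>
        (\<exists>j \<in> T - S. \<nu> S + \<nu> T \<le> \<nu> (insert j (S - {i})) + \<nu> (insert i (T - {j})))"
      using \<nu> unfolding Mnat_concave_def by blast
    then show "qpow q (\<nu> S) * qpow q (\<nu> T) \<le> qpow q (\<nu> (S - {i})) * qpow q (\<nu> (insert i T)) \<or>
        (\<exists>j \<in> T - S. qpow q (\<nu> S) * qpow q (\<nu> T) \<le> qpow q (\<nu> (insert j (S - {i}))) * qpow q (\<nu> (insert i (T - {j}))))"
      using qpow_mult_mono[OF q] fin by meson
  qed (rule qpow_nonneg)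
qed

text \<open>Contraction of \<open>A\<close> and deletion of everything outside A and B. Elements
  exchanged between two subsets of \<open>B\<close> lie in \<open>B\<close>, so the extension by
  zero is never entered.\<close>

lemma mult_exchange_minor:
  fixes w :: "'e set \<Rightarrow> real"
  assumes w: "mult_exchange w" and AB: "A \<inter> B = {}"
  shows "mult_exchange (\<lambda>S. if S \<subseteq> B then w (A \<union> S) else 0)" (is "mult_exchange ?m")
  unfolding mult_exchange_def
proof (intro conjI allI impI)
  have nn: "0 \<le> w S" for S by (rule mult_exchange_nonneg[OF w])
  then show m: "0 \<le> ?m S" for S by simp
  fix S T :: "'e set" and i assume i: "i \<in> S - T"
  show "?m S * ?m T \<le> ?m (S - {i}) * ?m (insert i T) \<or>
    (\<exists>j\<in>T - S. ?m S * ?m T \<le> ?m (insert j (S - {i})) * ?m (insert i (T - {j})))"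
  proof (cases "S \<subseteq> B \<and> T \<subseteq> B")
    case False
    then have "?m S * ?m T = 0" by auto
    then show ?thesis using m[of "S - {i}"] m[of "insert i T"] by (metis mult_nonneg_nonneg)
  next
    case True
    then have iA: "i \<notin> A" "i \<in> B" using i AB by auto
    have mST: "?m S = w (A \<union> S)" "?m T = w (A \<union> T)" using True by auto
    have "i \<in> A \<union> S" "i \<notin> A \<union> T" using i iA by auto
    from w this show ?thesis
    proof (cases rule: mult_exchangeD)
      case 1
      moreover have "A \<union> S - {i} = A \<union> (S - {i})" "insert i (A \<union> T) = A \<union> insert i T" using iA by auto
      moreover have "?m (S - {i}) = w (A \<union> (S - {i}))" "?m (insert i T) = w (A \<union> insert i T)" using True iA by auto
      ultimately have "?m S * ?m T \<le> ?m (S - {i}) * ?m (insert i T)" by (simp only: mST)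
      then show ?thesis ..
    next
      case (2 j)
      then have j: "j \<in> T - S" "j \<in> B" "j \<notin> A" using True by auto
      have "insert j (A \<union> S - {i}) = A \<union> insert j (S - {i})" "insert i (A \<union> T - {j}) = A \<union> insert i (T - {j})"
        using iA j by auto
      moreover have "?m (insert j (S - {i})) = w (A \<union> insert j (S - {i}))" "?m (insert i (T - {j})) = w (A \<union> insert i (T - {j}))"
        using True iA j by auto
      ultimately have "?m S * ?m T \<le> ?m (insert j (S - {i})) * ?m (insert i (T - {j}))"
        using 2(3) by (simp only: mST)
      then show ?thesis using j by blast
    qed
  qed
qed

lemma lookup_monexp:
  fixes S :: "'e::finite set"
  shows "Poly_Mapping.lookup (monexp S) i = (if i \<in> S then 1 else 0)"
  by (simp add: monexp_def lookup_sum lookup_single when_def)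

text \<open>A pair (S, T) contributes to the monomial \<open>m\<close> exactly if its intersection
  is \<open>A\<close> and its symmetric difference is \<open>B\<close>. Such pairs correspond to
  subsets of \<open>B\<close> through the intersection of S with B. The factor \<open>r\<close> lets
  one formula cover both sides of the claim.\<close>

lemma lookup_I_poly_mult:
  fixes \<nu> :: "'e::finite set \<Rightarrow> ereal" and m :: "'e \<Rightarrow>\<^sub>0 nat"
  defines "A \<equiv> {i. Poly_Mapping.lookup m i = 2}" and "B \<equiv> {i. Poly_Mapping.lookup m i = 1}"
  shows "Poly_Mapping.lookup (const_poly r * I_poly q \<nu> j * I_poly q \<nu> l) m =
    (if \<forall>i. Poly_Mapping.lookup m i \<le> 2
     then r * (\<Sum>S | S \<subseteq> B \<and> card A + card S = j \<and> card A + card (B - S) = l.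
                 qpow q (\<nu> (A \<union> S)) * qpow q (\<nu> (A \<union> (B - S)))) else 0)"
proof -
  define X where "X = {(S, T). card S = j \<and> card T = l \<and> monexp S + monexp T = m}"
  have "const_poly r * I_poly q \<nu> j * I_poly q \<nu> l =
      (\<Sum>S | card S = j. \<Sum>T | card T = l.
         Poly_Mapping.single (monexp S + monexp T) (r * (qpow q (\<nu> S) * qpow q (\<nu> T))))"
    unfolding const_poly_def I_poly_def sum_distrib_left[of "Poly_Mapping.single 0 r"] sum_product
    by (simp add: mult_single mult.assoc)
  also have "Poly_Mapping.lookup \<dots> m = (\<Sum>(S, T)\<in>{S. card S = j} \<times> {T. card T = l}.
      if monexp S + monexp T = m then r * (qpow q (\<nu> S) * qpow q (\<nu> T)) else 0)"
    by (simp add: lookup_sum lookup_single when_def sum.cartesian_product case_prod_unfold)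
  also have "\<dots> = (\<Sum>(S, T)\<in>X. r * (qpow q (\<nu> S) * qpow q (\<nu> T)))"
    unfolding X_def by (rule sum.mono_neutral_cong_right) (auto split: if_splits)
  finally have X: "Poly_Mapping.lookup (const_poly r * I_poly q \<nu> j * I_poly q \<nu> l) m = \<dots>" .
  have m: "Poly_Mapping.lookup m i = (if i \<in> S then 1 else 0) + (if i \<in> T then 1 else 0)"
    if "monexp S + monexp T = m" for S T i
    unfolding that[symmetric] by (simp add: lookup_add lookup_monexp)
  show ?thesis
  proof (cases "\<forall>i. Poly_Mapping.lookup m i \<le> 2")
    case False
    have "monexp S + monexp T \<noteq> m" for S T
      using False m[of S T] by (metis add_le_mono one_add_one order_refl zero_le_one)
    then have "X = {}" unfolding X_def by simp
    then show ?thesis unfolding X using False by auto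
  next
    case True
    have AB: "A \<inter> B = {}" unfolding A_def B_def by auto
    have mAB: "Poly_Mapping.lookup m i = (if i \<in> A then 2 else if i \<in> B then 1 else 0)" for i
      using True[rule_format, of i] unfolding A_def B_def by auto
    have "(\<Sum>(S, T)\<in>X. r * (qpow q (\<nu> S) * qpow q (\<nu> T)))
      = (\<Sum>S | S \<subseteq> B \<and> card A + card S = j \<and> card A + card (B - S) = l.
           r * (qpow q (\<nu> (A \<union> S)) * qpow q (\<nu> (A \<union> (B - S)))))"
    proof (rule sum.reindex_bij_witness[where i = "\<lambda>S. (A \<union> S, A \<union> (B - S))" and j = "\<lambda>(S, T). S \<inter> B"])
      fix P assume "P \<in> X"
      then obtain S T where P: "P = (S, T)" "card S = j" "card T = l" and st: "monexp S + monexp T = m"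
        unfolding X_def by auto
      have A: "i \<in> A \<longleftrightarrow> i \<in> S \<and> i \<in> T" and B: "i \<in> B \<longleftrightarrow> (i \<in> S) \<noteq> (i \<in> T)" for i
        unfolding A_def B_def using m[OF st, of i] by auto
      have ST: "A \<union> (S \<inter> B) = S" "A \<union> (B - S) = T" using A B by blast+
      have "A \<inter> (S \<inter> B) = {}" "A \<inter> (B - S) = {}" using AB by blast+
      then have cards: "card A + card (S \<inter> B) = card S" "card A + card (B - S) = card T"
        using ST by (metis card_Un_disjoint finite)+
      show "(case P of (S, T) \<Rightarrow> S \<inter> B) \<in> {S. S \<subseteq> B \<and> card A + card S = j \<and> card A + card (B - S) = l}"
        using P cards by (auto simp: Diff_Int)
      show "(A \<union> (case P of (S, T) \<Rightarrow> S \<inter> B), A \<union> (B - (case P of (S, T) \<Rightarrow> S \<inter> B))) = P"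
        using ST P by (simp add: Diff_Int)
      show "r * (qpow q (\<nu> (A \<union> (case P of (S, T) \<Rightarrow> S \<inter> B))) *
            qpow q (\<nu> (A \<union> (B - (case P of (S, T) \<Rightarrow> S \<inter> B)))))
          = (case P of (S, T) \<Rightarrow> r * (qpow q (\<nu> S) * qpow q (\<nu> T)))"
        using ST P by (simp add: Diff_Int)
    next
      fix S assume S: "S \<in> {S. S \<subseteq> B \<and> card A + card S = j \<and> card A + card (B - S) = l}"
      then show "(case (A \<union> S, A \<union> (B - S)) of (S, T) \<Rightarrow> S \<inter> B) = S" using AB by auto
      have "monexp (A \<union> S) + monexp (A \<union> (B - S)) = m"
        by (rule poly_mapping_eqI) (use S AB in \<open>auto simp: lookup_add lookup_monexp mAB\<close>)
      moreover have "card (A \<union> S) = card A + card S" "card (A \<union> (B - S)) = card A + card (B - S)"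
        by (rule card_Un_disjoint; use S AB in auto)+
      ultimately show "(A \<union> S, A \<union> (B - S)) \<in> X" unfolding X_def using S by auto
    qed
    then show ?thesis unfolding X using True by (simp add: sum_distrib_left)
  qed
qed

theorem theorem1p6:
  fixes \<nu> :: "'e::finite set \<Rightarrow> ereal" and q :: real and k :: nat
  assumes "Mnat_concave \<nu>"
    and "0 < k" and "k < CARD('e)"
    and "0 < q" and "q \<le> 1"
  shows "coeff_ge (I_poly q \<nu> k ^ 2)
           (const_poly (1 + 1 / real k) * I_poly q \<nu> (k - 1) * I_poly q \<nu> (k + 1))"
  unfolding coeff_ge_def
proof
  fix m :: "'e \<Rightarrow>\<^sub>0 nat"
  define A where "A = {i. Poly_Mapping.lookup m i = 2}"
  define B where "B = {i. Poly_Mapping.lookup m i = 1}"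
  define w where "w S = (if S \<subseteq> B then qpow q (\<nu> (A \<union> S)) else 0)" for S
  define C where "C j l = (\<Sum>S | S \<subseteq> B \<and> card A + card S = j \<and> card A + card (B - S) = l.
                 qpow q (\<nu> (A \<union> S)) * qpow q (\<nu> (A \<union> (B - S))))" for j l
  have coeff: "Poly_Mapping.lookup (const_poly r * I_poly q \<nu> j * I_poly q \<nu> l) m
      = (if \<forall>i. Poly_Mapping.lookup m i \<le> 2 then r * C j l else 0)" for r j l
    unfolding C_def A_def B_def by (rule lookup_I_poly_mult)
  have Cnn: "0 \<le> C j l" for j l
    unfolding C_def by (intro sum_nonneg mult_nonneg_nonneg qpow_nonneg)
  have w: "mult_exchange w"
    unfolding w_def using assms(1,4,5)
    by (intro mult_exchange_minor mult_exchange_qpow) (auto simp: A_def B_def)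
  have main: "(1 + 1 / real k) * C (k - 1) (k + 1) \<le> C k k"
  \<comment> \<open>Here \<open>p\<close> is the part of k - 1 that lies in \<open>B\<close>. If no
    such \<open>p\<close> exists, no split has sizes k - 1 and k + 1, and the right-hand coefficient
    is 0.\<close>
  proof (cases "\<exists>p. card B = 2 * Suc p \<and> k = card A + Suc p")
    case True
    then obtain p where p: "card B = 2 * Suc p" "k = card A + Suc p" by blast
    have C: "C j l = (\<Sum>S | S \<subseteq> B \<and> card S = b. w S * w (B - S))"
      if "j = card A + b" "l + b = card A + card B" for j l b
    proof -
      have "card A + card (B - S) = l" if S: "S \<subseteq> B" "card S = b" for S
        using \<open>l + b = _\<close> card_mono[OF _ S(1)] S by (simp add: card_Diff_subset finite_subset)
      then have "{S. S \<subseteq> B \<and> card A + card S = j \<and> card A + card (B - S) = l} = {S. S \<subseteq> B \<and> card S = b}"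
        using that(1) by auto
      then show ?thesis unfolding C_def w_def by (intro sum.cong) auto
    qed
    have "real (p + 2) * C (k - 1) (k + 1) \<le> real (p + 1) * C k k"
      using balanced_split_ineq[OF w _ p(1)] C[of "k - 1" p "k + 1"] C[of k "p + 1" k] p
      by (simp add: w_def split: if_splits)
    then have "(1 + 1 / real (p + 1)) * C (k - 1) (k + 1) \<le> C k k"
      by (simp add: field_simps)
    \<comment> \<open>From k = |A| + p + 1; the two factors agree when no variable is squared in the
      monomial.\<close>
    moreover have "(1 + 1 / real k) * C (k - 1) (k + 1) \<le> (1 + 1 / real (p + 1)) * C (k - 1) (k + 1)"
      using p(2) Cnn by (intro mult_right_mono add_mono divide_left_mono) auto
    ultimately show ?thesis by linarith
  next
    case False
    have "\<not> (S \<subseteq> B \<and> card A + card S = k - 1 \<and> card A + card (B - S) = k + 1)" for S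
    proof
      assume S: "S \<subseteq> B \<and> card A + card S = k - 1 \<and> card A + card (B - S) = k + 1"
      then have "card B = card S + card (B - S)" by (simp add: card_Diff_subset finite_subset card_mono)
      then have "card B = 2 * Suc (card S) \<and> k = card A + Suc (card S)" using S assms(2) by auto
      then show False using False by blast
    qed
    then have "{S. S \<subseteq> B \<and> card A + card S = k - 1 \<and> card A + card (B - S) = k + 1} = {}" by blast
    then have "C (k - 1) (k + 1) = 0" unfolding C_def by (simp only: sum.empty)
    then show ?thesis using Cnn by simp
  qed
  have one: "const_poly 1 = (1 :: 'e mpoly)" by (simp add: const_poly_def)
  have "Poly_Mapping.lookup (I_poly q \<nu> k ^ 2) m = (if \<forall>i. Poly_Mapping.lookup m i \<le> 2 then C k k else 0)"
    using coeff[of 1 k k] by (simp add: one power2_eq_square)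
  then show "0 \<le> Poly_Mapping.lookup (I_poly q \<nu> k ^ 2
      - const_poly (1 + 1 / real k) * I_poly q \<nu> (k - 1) * I_poly q \<nu> (k + 1)) m"
    unfolding lookup_minus coeff using main by simp
qed

end
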